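(* Let $c \geq 0$ be an integer and let $G$ be a (topologically) finitely generated profinite group. Then $G$ is virtually nilpotent of class at most $c$ if and only if the set $\{\gamma_{c+1}(K) \mid K \text{ an open normal subgroup of } G\}$ is finite.
   Context: For closed subgroups $K,L$ of a profinite group, $[K,L]$ denotes the closed subgroup generated by all commutators $[x,y]=x^{-1}y^{-1}xy$ with $x\in K$, $y\in L$. The lower central series of a profinite group $K$ is $\gamma_1(K)=K$, $\gamma_{i+1}(K)=[\gamma_i(K),K]$ (closed subgroups). A profinite group is virtually nilpotent of class at most $c$ if it has a subgroup $H$ of finite index (equivalently, an open subgroup $H$) with $\gamma_{c+1}(H)=1$; for $c=0$ this means finite. *)

theory Defs
  imports "HOL-Analysis.Analysis" "HOL-Algebra.Algebra"
begin

locale top_group = group G for G (structure) +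
  fixes T :: "'a topology"
  assumes topspace_eq_carrier: "topspace T = carrier G"
    and continuous_mult: "continuous_map (prod_topology T T) T (\<lambda>(x, y). x \<otimes> y)"
    and continuous_inv: "continuous_map T T (\<lambda>x. inv x)"

locale profinite_group = top_group +
  assumes compact: "compact_space T"
    and Hausdorff: "Hausdorff_space T"
    and totally_disconnected: "\<And>C. connectedin T C \<Longrightarrow> \<exists>x. C \<subseteq> {x}"

definition closed_generate :: "('a, 'b) monoid_scheme \<Rightarrow> 'a topology \<Rightarrow> 'a set \<Rightarrow> 'a set" where
  "closed_generate G T S = T closure_of (generate G S)"

definition top_fin_gen :: "('a, 'b) monoid_scheme \<Rightarrow> 'a topology \<Rightarrow> bool" where
  "top_fin_gen G T \<longleftrightarrow> (\<exists>S. finite S \<and> S \<subseteq> carrier G \<and> closed_generate G T S = carrier G)"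

definition closed_commutator ::
    "('a, 'b) monoid_scheme \<Rightarrow> 'a topology \<Rightarrow> 'a set \<Rightarrow> 'a set \<Rightarrow> 'a set" where
  "closed_commutator G T K L = closed_generate G T
     {inv\<^bsub>G\<^esub> x \<otimes>\<^bsub>G\<^esub> inv\<^bsub>G\<^esub> y \<otimes>\<^bsub>G\<^esub> x \<otimes>\<^bsub>G\<^esub> y | x y. x \<in> K \<and> y \<in> L}"

text \<open>Indexing starts at 1, so that \<open>lower_central G T 1 K = K\<close>; the value at 0 is a dummy.\<close>

fun lower_central :: "('a, 'b) monoid_scheme \<Rightarrow> 'a topology \<Rightarrow> nat \<Rightarrow> 'a set \<Rightarrow> 'a set" where
  "lower_central G T 0 K = K"
| "lower_central G T (Suc 0) K = K"
| "lower_central G T (Suc (Suc i)) K = closed_commutator G T (lower_central G T (Suc i) K) K"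

text \<open>The subgroup \<open>H\<close> need not be closed. All commutator subgroups are closed in \<open>G\<close>, and
  the terms of index at least 2 are those of the closure of \<open>H\<close>, which also has finite index
  and is therefore open. Requiring \<open>H\<close> to be open would thus give the same notion.\<close>

definition virtually_nilpotent :: "('a, 'b) monoid_scheme \<Rightarrow> 'a topology \<Rightarrow> nat \<Rightarrow> bool" where
  "virtually_nilpotent G T c \<longleftrightarrow>
     (\<exists>H. subgroup H G \<and> finite (rcosets\<^bsub>G\<^esub> H) \<and> lower_central G T (c + 1) H = {\<one>\<^bsub>G\<^esub>})"

end

theory Submission
  imports Defs
begin

text \<open>
  If the family of all \<open>\<gamma>\<^sub>c\<^sub>+\<^sub>1(K)\<close> is finite, then some \<open>\<gamma>\<^sub>c\<^sub>+\<^sub>1(N)\<close> is contained in every open normal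
  subgroup and hence trivial. Conversely, let \<open>H\<close> be open normal with \<open>\<gamma>\<^sub>c\<^sub>+\<^sub>1(H) = 1\<close> and, for \<open>K\<close>
  open normal, put \<open>M = KH\<close>. Expanding commutators of weight \<open>2c + 1\<close> in \<open>M\<close> into commutators with
  entries in \<open>K\<close> or \<open>H\<close>, each of them has at least \<open>c + 1\<close> entries in \<open>H\<close> (and vanishes) or at
  least \<open>c + 1\<close> entries in \<open>K\<close>, so \<open>\<gamma>\<^sub>2\<^sub>c\<^sub>+\<^sub>1(M) \<subseteq> \<gamma>\<^sub>c\<^sub>+\<^sub>1(K) \<subseteq> \<gamma>\<^sub>c\<^sub>+\<^sub>1(M)\<close>. There are finitely
  many \<open>M \<supseteq> H\<close>, and \<open>\<gamma>\<^sub>c\<^sub>+\<^sub>1(M)/\<gamma>\<^sub>2\<^sub>c\<^sub>+\<^sub>1(M)\<close> is finite: for \<open>i > c\<close> the abelian group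
  \<open>\<gamma>\<^sub>i(M)/\<gamma>\<^sub>i\<^sub>+\<^sub>1(M)\<close> is generated by finitely many commutators \<open>[x\<^sub>1, \<dots>, x\<^sub>i]\<close>, and a power of each
  is congruent to some \<open>[x\<^sub>1\<^sup>m, \<dots>, x\<^sub>i\<^sup>m] \<in> \<gamma>\<^sub>i(H) = 1\<close>.
\<close>

section \<open>Commutators and subgroups of finite index\<close>

context group
begin

section \<open>Commutator calculus in an abstract group\<close>

lemma inv_mult_cancel: "\<lbrakk>x \<in> carrier G; y \<in> carrier G\<rbrakk> \<Longrightarrow> inv x \<otimes> (x \<otimes> y) = y"
  by (simp flip: m_assoc)

lemma mult_inv_cancel: "\<lbrakk>x \<in> carrier G; y \<in> carrier G\<rbrakk> \<Longrightarrow> x \<otimes> (inv x \<otimes> y) = y"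
  by (simp flip: m_assoc)

lemmas group_simps = m_assoc inv_mult_group inv_mult_cancel mult_inv_cancel

definition comm :: "'a \<Rightarrow> 'a \<Rightarrow> 'a" where
  "comm x y = inv x \<otimes> inv y \<otimes> x \<otimes> y"

lemma comm_closed [simp, intro]:
  "\<lbrakk>x \<in> carrier G; y \<in> carrier G\<rbrakk> \<Longrightarrow> comm x y \<in> carrier G"
  by (simp add: comm_def)

lemma inv_comm: "\<lbrakk>x \<in> carrier G; y \<in> carrier G\<rbrakk> \<Longrightarrow> inv (comm x y) = comm y x"
  by (simp add: comm_def group_simps)

lemma comm_mult_left:
  "\<lbrakk>x \<in> carrier G; x' \<in> carrier G; y \<in> carrier G\<rbrakk>
    \<Longrightarrow> comm (x \<otimes> x') y = inv x' \<otimes> comm x y \<otimes> x' \<otimes> comm x' y"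
  by (simp add: comm_def group_simps)

lemma comm_inv_left:
  "\<lbrakk>x \<in> carrier G; y \<in> carrier G\<rbrakk> \<Longrightarrow> comm (inv x) y = x \<otimes> inv (comm x y) \<otimes> inv x"
  by (simp add: comm_def group_simps)

lemma conj_comm:
  "\<lbrakk>g \<in> carrier G; x \<in> carrier G; y \<in> carrier G\<rbrakk>
    \<Longrightarrow> g \<otimes> comm x y \<otimes> inv g = comm (g \<otimes> x \<otimes> inv g) (g \<otimes> y \<otimes> inv g)"
  by (simp add: comm_def group_simps)

lemma mult_eq_mult_comm:
  "\<lbrakk>x \<in> carrier G; y \<in> carrier G\<rbrakk> \<Longrightarrow> x \<otimes> y = y \<otimes> x \<otimes> comm x y"
  by (simp add: comm_def group_simps)

text \<open>Kept relative to \<open>M\<close>: the subgroup \<open>N\<close> built in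
  \<open>gam_torsion_generators\<close> is shown to be stable under conjugation by \<open>M\<close>
  only.\<close>

definition normalizes :: "'a set \<Rightarrow> 'a set \<Rightarrow> bool" where
  "normalizes M N \<longleftrightarrow> (\<forall>g\<in>M. \<forall>n\<in>N. g \<otimes> n \<otimes> inv g \<in> N)"

lemma normalizesD:
  assumes "normalizes M N" "subgroup M G" "g \<in> M" "n \<in> N"
  shows "g \<otimes> n \<otimes> inv g \<in> N" "inv g \<otimes> n \<otimes> g \<in> N"
proof -
  show "g \<otimes> n \<otimes> inv g \<in> N"
    using assms by (auto simp: normalizes_def)
  have "inv g \<in> M" using assms by (simp add: subgroup.m_inv_closed)
  then have "inv g \<otimes> n \<otimes> inv (inv g) \<in> N"
    using assms by (auto simp: normalizes_def)
  then show "inv g \<otimes> n \<otimes> g \<in> N"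
    using assms(2,3) by (simp add: subgroup.mem_carrier)
qed

text \<open>\<open>[x x', y]\<close> is a conjugate of \<open>[x, y]\<close> times
  \<open>[x', y]\<close>, and \<open>[x^-1, y]\<close> is a conjugate of the inverse of
  \<open>[x, y]\<close>; the conjugating elements lie in \<open>M\<close>, so \<open>N\<close>
  absorbs them.\<close>

lemma comm_left_subgroup:
  assumes M: "subgroup M G" and N: "subgroup N G" "normalizes M N" and Y: "Y \<subseteq> carrier G"
  shows "subgroup {x \<in> M. \<forall>y\<in>Y. comm x y \<in> N} G"
proof (rule subgroupI)
  show "{x \<in> M. \<forall>y\<in>Y. comm x y \<in> N} \<subseteq> carrier G"
    using M subgroup.subset by blast
  have "\<one> \<in> {x \<in> M. \<forall>y\<in>Y. comm x y \<in> N}"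
    using M N Y by (auto simp: subgroup.one_closed comm_def)
  then show "{x \<in> M. \<forall>y\<in>Y. comm x y \<in> N} \<noteq> {}" by blast
next
  fix a assume "a \<in> {x \<in> M. \<forall>y\<in>Y. comm x y \<in> N}"
  then show "inv a \<in> {x \<in> M. \<forall>y\<in>Y. comm x y \<in> N}"
    using M N Y normalizesD(1)[OF N(2) M]
    by (auto simp: subgroup.m_inv_closed subgroup.mem_carrier comm_inv_left subsetD)
next
  fix a b assume "a \<in> {x \<in> M. \<forall>y\<in>Y. comm x y \<in> N}" "b \<in> {x \<in> M. \<forall>y\<in>Y. comm x y \<in> N}"
  then show "a \<otimes> b \<in> {x \<in> M. \<forall>y\<in>Y. comm x y \<in> N}"
    using M N Y normalizesD(2)[OF N(2) M]
    by (auto simp: subgroup.m_closed subgroup.mem_carrier comm_mult_left subsetD)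
qed

lemma comm_mem_swap:
  assumes "subgroup N G" "x \<in> carrier G" "y \<in> carrier G"
  shows "comm x y \<in> N \<longleftrightarrow> comm y x \<in> N"
  using assms by (metis inv_comm subgroup.m_inv_closed)

lemma comm_right_subgroup:
  assumes M: "subgroup M G" and N: "subgroup N G" "normalizes M N" and S: "S \<subseteq> carrier G"
  shows "subgroup {y \<in> M. \<forall>x\<in>S. comm x y \<in> N} G"
proof -
  have "{y \<in> M. \<forall>x\<in>S. comm x y \<in> N} = {y \<in> M. \<forall>x\<in>S. comm y x \<in> N}"
    using comm_mem_swap[OF N(1)] subgroup.mem_carrier[OF M] S by blast
  with comm_left_subgroup[OF assms] show ?thesis by simp
qed

text \<open>Moving one \<open>x\<close> past one \<open>y\<close> costs one factor
  \<open>comm x y\<close>, which commutes with both; moving \<open>x^a\<close> past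
  \<open>y^b\<close> therefore costs \<open>a * b\<close> factors. The two inductions, on
  \<open>b\<close> and then on \<open>a\<close>, count them.\<close>

lemma comm_pow_central:
  assumes x: "x \<in> carrier G" and y: "y \<in> carrier G"
    and cx: "comm x y \<otimes> x = x \<otimes> comm x y" and cy: "comm x y \<otimes> y = y \<otimes> comm x y"
  shows "comm (x [^] a) (y [^] b) = comm x y [^] (a * b :: nat)"
proof -
  let ?c = "comm x y"
  have c: "?c \<in> carrier G" using x y by simp
  have 1: "x \<otimes> y [^] b = y [^] b \<otimes> x \<otimes> ?c [^] b"
  proof (induction b)
    case (Suc b)
    have "x \<otimes> y [^] Suc b = y [^] b \<otimes> x \<otimes> ?c [^] b \<otimes> y"
      using Suc x y by (simp add: m_assoc[symmetric])
    also have "\<dots> = y [^] b \<otimes> x \<otimes> (y \<otimes> ?c [^] b)"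
      using x y c pow_mult_distrib by (simp add: m_assoc group_commutes_pow[OF cy])
    also have "\<dots> = y [^] b \<otimes> (x \<otimes> y) \<otimes> ?c [^] b"
      using x y c by (simp add: m_assoc)
    also have "x \<otimes> y = y \<otimes> x \<otimes> ?c" using mult_eq_mult_comm x y by blast
    also have "y [^] b \<otimes> (y \<otimes> x \<otimes> ?c) \<otimes> ?c [^] b = y [^] Suc b \<otimes> x \<otimes> ?c [^] Suc b"
      using x y c by (simp add: m_assoc nat_pow_Suc2[symmetric] del: nat_pow_Suc)
    finally show ?case .
  qed (use x in simp)
  have cx': "?c [^] n \<otimes> x = x \<otimes> ?c [^] n" for n :: nat
    using group_commutes_pow[OF cx] x c by simp
  have 2: "x [^] a \<otimes> y [^] b = y [^] b \<otimes> x [^] a \<otimes> ?c [^] (a * b)"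
  proof (induction a)
    case (Suc a)
    have "x [^] Suc a \<otimes> y [^] b = x [^] a \<otimes> (x \<otimes> y [^] b)"
      using x y by (simp add: m_assoc)
    also have "\<dots> = (x [^] a \<otimes> y [^] b) \<otimes> x \<otimes> ?c [^] b"
      using x y c by (simp add: 1 m_assoc)
    also have "\<dots> = y [^] b \<otimes> x [^] a \<otimes> (?c [^] (a * b) \<otimes> x) \<otimes> ?c [^] b"
      using x y c Suc by (simp add: m_assoc)
    also have "\<dots> = y [^] b \<otimes> x [^] Suc a \<otimes> ?c [^] (Suc a * b)"
      using x y c by (simp add: cx' m_assoc nat_pow_mult add.commute)
    finally show ?case .
  qed (use y in simp)
  have "comm (x [^] a) (y [^] b) = inv (x [^] a) \<otimes> (inv (y [^] b) \<otimes> (x [^] a \<otimes> y [^] b))"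
    using x y by (simp add: comm_def m_assoc)
  also have "\<dots> = ?c [^] (a * b)"
    unfolding 2 using x y c by (simp add: group_simps)
  finally show ?thesis .
qed

text \<open>Modulo \<open>N\<close> the commutator of \<open>x\<close> and \<open>y\<close> commutes
  with both, so \<open>comm_pow_central\<close> applies in the quotient. This turns torsion of
  \<open>x\<close> and \<open>y\<close> into torsion of their commutator.\<close>

lemma comm_pow_mem_normal:
  assumes N: "N \<lhd> G" and x: "x \<in> carrier G" and y: "y \<in> carrier G"
    and cx: "comm (comm x y) x \<in> N" and cy: "comm (comm x y) y \<in> N"
    and pow: "comm (x [^] a) (y [^] b) \<in> N"
  shows "comm x y [^] (a * b :: nat) \<in> N"
proof -
  interpret N: normal N G by fact
  interpret Q: group "G Mod N" by (rule N.factorgroup_is_group)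
  let ?p = "\<lambda>a. N #> a"
  interpret p: group_hom G "G Mod N" ?p
    by (intro group_hom.intro group_hom_axioms.intro N.r_coset_hom_Mod) (auto simp: is_group Q.is_group)
  have p_comm: "?p (comm u v) = Q.comm (?p u) (?p v)" if "u \<in> carrier G" "v \<in> carrier G" for u v
    using that by (simp add: comm_def Q.comm_def)
  have p_one: "?p u = N \<longleftrightarrow> u \<in> N" if "u \<in> carrier G" for u
    using that N.rcos_const[OF is_group, of u] rcos_self[OF that N.is_subgroup]
    by auto
  have swap: "Q.comm (?p x) (?p y) \<otimes>\<^bsub>G Mod N\<^esub> ?p z = ?p z \<otimes>\<^bsub>G Mod N\<^esub> Q.comm (?p x) (?p y)"
    if z: "z \<in> carrier G" "comm (comm x y) z \<in> N" for z
  proof -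
    have "Q.comm (?p (comm x y)) (?p z) = \<one>\<^bsub>G Mod N\<^esub>"
      using z x y by (simp add: p_one p_comm[symmetric] del: p.hom_mult)
    then have "?p (comm x y) \<otimes>\<^bsub>G Mod N\<^esub> ?p z = ?p z \<otimes>\<^bsub>G Mod N\<^esub> ?p (comm x y)"
      using Q.mult_eq_mult_comm Q.r_one Q.m_closed p.hom_closed comm_closed z(1) x y by metis
    then show ?thesis using x y by (simp add: p_comm)
  qed
  have "?p (comm x y [^] (a * b)) = Q.comm (?p x) (?p y) [^]\<^bsub>G Mod N\<^esub> (a * b)"
    using x y by (simp add: p.hom_nat_pow p_comm)
  also have "\<dots> = Q.comm (?p x [^]\<^bsub>G Mod N\<^esub> a) (?p y [^]\<^bsub>G Mod N\<^esub> b)"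
    using x y swap cx cy by (intro Q.comm_pow_central[symmetric]) auto
  also have "\<dots> = ?p (comm (x [^] a) (y [^] b))"
    using x y by (simp add: p.hom_nat_pow p_comm)
  also have "\<dots> = \<one>\<^bsub>G Mod N\<^esub>"
    using pow x y by (simp add: p_one)
  finally show ?thesis using x y p_one[of "comm x y [^] (a * b)"] by simp
qed

section \<open>Finite index and finitely generated torsion sections\<close>

lemma generate_sincl: "S \<subseteq> generate G S"
  by (auto intro: generate.incl)

text \<open>Finitely many left translates \<open>f B\<close>, with \<open>f\<close> anywhere in
  \<open>G\<close>, cover \<open>A\<close>. For a subgroup \<open>B\<close> of a subgroup
  \<open>A\<close> this says that the index is finite; the form for sets survives shrinking
  \<open>A\<close> and enlarging \<open>B\<close>, and passes to the closure of \<open>A\<close>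
  when \<open>B\<close> is closed.\<close>

definition fin_index :: "'a set \<Rightarrow> 'a set \<Rightarrow> bool" where
  "fin_index A B \<longleftrightarrow> (\<exists>F. finite F \<and> F \<subseteq> carrier G \<and> (\<forall>a\<in>A. \<exists>f\<in>F. inv f \<otimes> a \<in> B))"

lemma fin_index_trans:
  assumes "fin_index A B" "fin_index B C" "A \<subseteq> carrier G"
  shows "fin_index A C"
proof -
  from assms obtain E F where E: "finite E" "E \<subseteq> carrier G" "\<forall>a\<in>A. \<exists>e\<in>E. inv e \<otimes> a \<in> B"
    and F: "finite F" "F \<subseteq> carrier G" "\<forall>b\<in>B. \<exists>f\<in>F. inv f \<otimes> b \<in> C"
    unfolding fin_index_def by metis
  let ?P = "(\<lambda>(e, f). e \<otimes> f) ` (E \<times> F)"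
  have "\<exists>g\<in>?P. inv g \<otimes> a \<in> C" if a: "a \<in> A" for a
  proof -
    from a E obtain e where e: "e \<in> E" "inv e \<otimes> a \<in> B" by blast
    with F obtain f where f: "f \<in> F" "inv f \<otimes> (inv e \<otimes> a) \<in> C" by blast
    have "inv f \<otimes> (inv e \<otimes> a) = inv (e \<otimes> f) \<otimes> a"
      using e f E F a assms(3) by (simp add: group_simps subsetD)
    with e f show ?thesis by force
  qed
  moreover have "finite ?P" "?P \<subseteq> carrier G" using E F by auto
  ultimately show ?thesis unfolding fin_index_def by blast
qed

lemma fin_index_mono:
  "\<lbrakk>fin_index A B; A' \<subseteq> A; B \<subseteq> B'\<rbrakk> \<Longrightarrow> fin_index A' B'"
  unfolding fin_index_def by (meson subset_eq)

text \<open>\<open>L\<close> is determined by the subset \<open>F \<inter> L\<close> of the finite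
  set \<open>F\<close>: if \<open>inv f \<otimes> a\<close> lies in \<open>B\<close>, hence in
  \<open>L\<close>, then \<open>a\<close> lies in \<open>L\<close> exactly when \<open>f\<close>
  does.\<close>

lemma finite_intermediate_subgroups:
  assumes "fin_index A B" and A: "A \<subseteq> carrier G"
  shows "finite {L. subgroup L G \<and> B \<subseteq> L \<and> L \<subseteq> A}"
proof -
  from assms obtain F where F: "finite F" "F \<subseteq> carrier G" "\<forall>a\<in>A. \<exists>f\<in>F. inv f \<otimes> a \<in> B"
    unfolding fin_index_def by blast
  have eq: "L = {a \<in> A. \<exists>f\<in>F \<inter> L. inv f \<otimes> a \<in> B}" if L: "subgroup L G" "B \<subseteq> L" "L \<subseteq> A" for L
  proof -
    interpret L: subgroup L G by fact
    have "\<exists>f\<in>F \<inter> L. inv f \<otimes> a \<in> B" if a: "a \<in> L" for a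
    proof -
      from F a L obtain f where f: "f \<in> F" "inv f \<otimes> a \<in> B" by blast
      have fc: "f \<in> carrier G" "a \<in> carrier G" using f F a by auto
      have "a \<otimes> inv (inv f \<otimes> a) \<in> L" using f a L by blast
      then have "f \<in> L" using fc by (simp add: group_simps)
      with f show ?thesis by blast
    qed
    moreover have "a \<in> L" if "a \<in> A" "f \<in> F \<inter> L" "inv f \<otimes> a \<in> B" for a f
    proof -
      have "f \<otimes> (inv f \<otimes> a) \<in> L" using that L by blast
      then show ?thesis using A that by (simp add: group_simps subsetD)
    qed
    ultimately show ?thesis using L by blast
  qed
  have "{L. subgroup L G \<and> B \<subseteq> L \<and> L \<subseteq> A} \<subseteq> (\<lambda>E. {a \<in> A. \<exists>f\<in>E. inv f \<otimes> a \<in> B}) ` Pow F"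
    using eq by blast
  then show ?thesis by (rule finite_subset) (use F(1) in simp)
qed

text \<open>\<open>rcosets H\<close> consists of right cosets whereas \<open>fin_index\<close>
  counts left translates; inverting representatives exchanges the two.\<close>

lemma finite_rcosets_iff_fin_index:
  assumes H: "subgroup H G"
  shows "finite (rcosets H) \<longleftrightarrow> fin_index (carrier G) H"
proof
  interpret H: subgroup H G by fact
  assume fin: "finite (rcosets H)"
  have "\<forall>C\<in>rcosets H. \<exists>r\<in>carrier G. C = H #> r"
    by (auto simp: RCOSETS_def)
  then obtain r where r: "\<And>C. C \<in> rcosets H \<Longrightarrow> r C \<in> carrier G \<and> C = H #> r C" by metis
  let ?F = "(\<lambda>C. inv (r C)) ` (rcosets H)"
  have "\<exists>f\<in>?F. inv f \<otimes> a \<in> H" if a: "a \<in> carrier G" for a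
  proof -
    let ?C = "H #> inv a"
    have C: "?C \<in> rcosets H" using a by (auto simp: RCOSETS_def)
    have "inv a \<in> ?C" using a by (simp add: rcos_self H)
    then obtain h where h: "h \<in> H" "inv a = h \<otimes> r ?C"
      using r[OF C] by (auto simp: r_coset_def)
    have hc: "h \<in> carrier G" "r ?C \<in> carrier G" using h r[OF C] by auto
    have "a = inv (h \<otimes> r ?C)" using h a by (metis inv_inv)
    then have "r ?C \<otimes> a = inv h"
      using hc by (metis inv_closed inv_mult_group mult_inv_cancel)
    then have "inv (inv (r ?C)) \<otimes> a \<in> H" using h r[OF C] by simp
    with C show ?thesis by blast
  qed
  moreover have "finite ?F" "?F \<subseteq> carrier G" using fin r by auto
  ultimately show "fin_index (carrier G) H" unfolding fin_index_def by blast
next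
  interpret H: subgroup H G by fact
  assume "fin_index (carrier G) H"
  then obtain F where F: "finite F" "F \<subseteq> carrier G" "\<forall>a\<in>carrier G. \<exists>f\<in>F. inv f \<otimes> a \<in> H"
    unfolding fin_index_def by blast
  have "rcosets H \<subseteq> (\<lambda>f. H #> inv f) ` F"
  proof
    fix C assume "C \<in> rcosets H"
    then obtain a where a: "a \<in> carrier G" "C = H #> a" by (auto simp: RCOSETS_def)
    from F a obtain f where f: "f \<in> F" "inv f \<otimes> inv a \<in> H" by (meson inv_closed)
    have "inv (inv f \<otimes> inv a) \<in> H" using f by blast
    then have "a \<otimes> f \<in> H" using f F a by (simp add: group_simps subsetD)
    moreover have "a = (a \<otimes> f) \<otimes> inv f" using f F a by (simp add: group_simps subsetD)
    ultimately have "a \<in> H #> inv f" unfolding r_coset_def by blast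
    then have "H #> a = H #> inv f"
      using f F by (metis repr_independence H inv_closed subsetD)
    with a f show "C \<in> (\<lambda>f. H #> inv f) ` F" by blast
  qed
  then show "finite (rcosets H)" by (rule finite_subset) (use F(1) in simp)
qed

text \<open>The quotient \<open>A / N\<close> is abelian and \<open>x\<close> is torsion in it, so
  adjoining \<open>x\<close> to \<open>B\<close> yields only products
  \<open>x [^] j \<otimes> b\<close>, and the powers with exponent below \<open>n\<close> represent
  all cosets of \<open>B\<close>.\<close>

lemma fin_index_generate_insert:
  assumes A: "subgroup A G" and N: "subgroup N G" "N \<subseteq> A"
    and ab: "\<And>a b. \<lbrakk>a \<in> A; b \<in> A\<rbrakk> \<Longrightarrow> comm a b \<in> N"
    and B: "subgroup B G" "N \<subseteq> B" "B \<subseteq> A"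
    and x: "x \<in> A" "x [^] n \<in> N" "n > (0::nat)"
  shows "fin_index (generate G (insert x B)) B"
proof -
  interpret A: subgroup A G by fact
  interpret B: subgroup B G by fact
  interpret N: subgroup N G by fact
  define P where "P = {x [^] j \<otimes> b | j b. (j::nat) \<in> UNIV \<and> b \<in> B}"
  have xc [simp]: "x \<in> carrier G" using x(1) by (rule A.mem_carrier)
  have pow: "x [^] j \<in> A" for j :: nat using x by (induction j) auto
  have mult: "u \<otimes> v \<in> P" if uv: "u \<in> P" "v \<in> P" for u v
  proof -
    obtain i b where u: "u = x [^] (i::nat) \<otimes> b" "b \<in> B" using uv by (auto simp: P_def)
    obtain j d where v: "v = x [^] (j::nat) \<otimes> d" "d \<in> B" using uv by (auto simp: P_def)
    have c: "comm b (x [^] j) \<in> B" using ab[of b "x [^] j"] u pow B by blast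
    have "u \<otimes> v = x [^] i \<otimes> (b \<otimes> x [^] j) \<otimes> d"
      using u v by (simp add: m_assoc)
    also have "b \<otimes> x [^] j = x [^] j \<otimes> b \<otimes> comm b (x [^] j)"
      using u by (simp add: mult_eq_mult_comm[of b])
    also have "x [^] i \<otimes> (x [^] j \<otimes> b \<otimes> comm b (x [^] j)) \<otimes> d
        = x [^] (i + j) \<otimes> (b \<otimes> comm b (x [^] j) \<otimes> d)"
      using u v by (simp add: m_assoc nat_pow_mult[symmetric])
    finally show ?thesis unfolding P_def using u v c by blast
  qed
  have BS: "b \<in> P" if "b \<in> B" for b
    unfolding P_def using that by (intro CollectI exI[of _ "0::nat"] exI[of _ b]) simp
  have npow: "(x [^] n) [^] k \<in> N" for k :: nat
    using x(2) by (induction k) auto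
  \<comment> \<open>Only natural exponents occur in \<open>P\<close>. With
    \<open>m = n * j - j\<close>, the inverse of \<open>x [^] j\<close> is \<open>x [^] m\<close>
    times an element of \<open>N\<close>.\<close>
  have inv_pow: "inv (x [^] j) \<in> P" for j :: nat
  proof -
    obtain m where m: "n * j = m + j" using x(3)
      by (metis Suc_pred mult_Suc add.commute)
    have "x [^] (n * j) \<in> N" using npow[of j] by (simp add: nat_pow_pow)
    then have "inv (x [^] (n * j)) \<in> B" using B by blast
    moreover have "x [^] (n * j) = x [^] j \<otimes> x [^] m"
      by (simp add: m nat_pow_mult add.commute)
    then have "inv (x [^] j) = x [^] m \<otimes> inv (x [^] (n * j))"
      by (simp add: group_simps)
    ultimately show ?thesis unfolding P_def by blast
  qed
  have P: "subgroup P G"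
  proof (rule subgroupI)
    show "P \<subseteq> carrier G" by (auto simp: P_def)
    show "P \<noteq> {}" using BS[OF B.one_closed] by blast
    fix u assume "u \<in> P"
    then obtain j b where u: "u = x [^] (j::nat) \<otimes> b" "b \<in> B" by (auto simp: P_def)
    have "inv u = inv b \<otimes> inv (x [^] j)" using u by (simp add: inv_mult_group)
    with mult[OF BS inv_pow] u show "inv u \<in> P" by simp
  qed (use mult in blast)
  have "x \<in> P" unfolding P_def by (intro CollectI exI[of _ "1::nat"] exI[of _ \<one>]) simp
  with BS have sub: "generate G (insert x B) \<subseteq> P"
    by (intro generate_subgroup_incl[OF _ P]) blast
  let ?F = "(\<lambda>j. x [^] j) ` {..<n}"
  have "\<exists>f\<in>?F. inv f \<otimes> a \<in> B" if "a \<in> P" for a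
  proof -
    obtain j b where a: "a = x [^] (j::nat) \<otimes> b" "b \<in> B" using \<open>a \<in> P\<close> by (auto simp: P_def)
    have "x [^] j = x [^] (j mod n) \<otimes> (x [^] n) [^] (j div n)"
      by (simp add: nat_pow_pow nat_pow_mult)
    then have "inv (x [^] (j mod n)) \<otimes> a = (x [^] n) [^] (j div n) \<otimes> b"
      using a by (simp add: group_simps)
    then have "inv (x [^] (j mod n)) \<otimes> a \<in> B" using npow[of "j div n"] B a by auto
    with x(3) show ?thesis by force
  qed
  then have "fin_index P B"
    unfolding fin_index_def by (intro exI[of _ ?F]) auto
  then show ?thesis by (rule fin_index_mono) (use sub in auto)
qed

text \<open>Relative form of the finiteness of a finitely generated abelian torsion group; the
  generators are adjoined to \<open>N\<close> one at a time.\<close>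

lemma fin_index_generate_torsion:
  assumes A: "subgroup A G" and N: "subgroup N G" "N \<subseteq> A"
    and ab: "\<And>a b. \<lbrakk>a \<in> A; b \<in> A\<rbrakk> \<Longrightarrow> comm a b \<in> N"
    and S: "finite S" "S \<subseteq> A" "\<And>x. x \<in> S \<Longrightarrow> \<exists>n>0. x [^] (n::nat) \<in> N"
  shows "fin_index (generate G (S \<union> N)) N"
  using S
proof (induction S)
  case empty
  have "generate G N = N"
    using N(1) generate_subgroup_incl[of N N] generate_sincl by blast
  then show ?case
    using N(1) subgroup.mem_carrier unfolding fin_index_def
    by (intro exI[of _ "{\<one>}"]) fastforce
next
  case (insert x S)
  interpret A: subgroup A G by fact
  let ?B = "generate G (S \<union> N)"
  have XN: "S \<union> N \<subseteq> carrier G" "S \<union> N \<subseteq> A" using insert.prems N by auto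
  have B: "subgroup ?B G" "N \<subseteq> ?B" "?B \<subseteq> A"
    using generate_is_subgroup[OF XN(1)] generate_sincl[of "S \<union> N"] generate_subgroup_incl[OF XN(2) A]
    by blast+
  obtain n where n: "n > (0::nat)" "x [^] n \<in> N" using insert.prems by blast
  have 1: "fin_index (generate G (insert x ?B)) ?B"
    by (rule fin_index_generate_insert[OF A N ab B _ n(2,1)]) (use insert.prems in auto)
  have 2: "fin_index ?B N" using insert by blast
  have "insert x ?B \<subseteq> carrier G" using B insert.prems by auto
  then have "generate G (insert x ?B) \<subseteq> carrier G" by (rule generate_incl)
  then have 3: "fin_index (generate G (insert x ?B)) N" by (rule fin_index_trans[OF 1 2])
  have "insert x S \<union> N \<subseteq> insert x ?B" using generate_sincl[of "S \<union> N"] by blast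
  then have "generate G (insert x S \<union> N) \<subseteq> generate G (insert x ?B)"
    by (rule mono_generate)
  then show ?case using fin_index_mono[OF 3] by blast
qed

text \<open>Pigeonhole: two powers \<open>x [^] i\<close> and \<open>x [^] j\<close> with
  \<open>i < j\<close> fall into the same left coset of \<open>N\<close>.\<close>

lemma fin_index_normal_torsion:
  assumes N: "N \<lhd> G" and fin: "fin_index (carrier G) N" and x: "x \<in> carrier G"
  shows "\<exists>n>0. x [^] (n::nat) \<in> N"
proof -
  interpret N: subgroup N G using N normal_imp_subgroup by blast
  obtain F where F: "finite F" "F \<subseteq> carrier G" "\<forall>a\<in>carrier G. \<exists>f\<in>F. inv f \<otimes> a \<in> N"
    using fin unfolding fin_index_def by blast
  then obtain f where f: "\<And>a. a \<in> carrier G \<Longrightarrow> f a \<in> F \<and> inv (f a) \<otimes> a \<in> N" by metis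
  have "\<not> inj (\<lambda>j::nat. f (x [^] j))"
    using F(1) f x by (intro notI) (meson finite_subset image_subset_iff infinite_UNIV_nat finite_imageD nat_pow_closed)
  then obtain i j :: nat where "i < j" "f (x [^] i) = f (x [^] j)"
    unfolding inj_def by (metis linorder_neqE_nat)
  define g where "g = f (x [^] i)"
  have g: "inv g \<otimes> x [^] i \<in> N" "inv g \<otimes> x [^] j \<in> N" "g \<in> carrier G"
    using f[of "x [^] i"] f[of "x [^] j"] x F \<open>f (x [^] i) = _\<close> by (auto simp: g_def)
  have "inv (inv g \<otimes> x [^] i) \<otimes> (inv g \<otimes> x [^] j) \<in> N" using g by blast
  then have "inv (x [^] i) \<otimes> x [^] j \<in> N" using x g by (simp add: group_simps)
  moreover have "x [^] j = x [^] i \<otimes> x [^] (j - i)" using x \<open>i < j\<close> by (simp add: nat_pow_mult)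
  ultimately have "x [^] (j - i) \<in> N" using x by (simp add: group_simps)
  then show ?thesis using \<open>i < j\<close> by (metis zero_less_diff)
qed

end

section \<open>Closed subgroups\<close>

context top_group
begin

lemma continuous_map_mult:
  assumes "continuous_map Z T f" "continuous_map Z T g"
  shows "continuous_map Z T (\<lambda>z. f z \<otimes> g z)"
proof -
  have "continuous_map Z (prod_topology T T) (\<lambda>z. (f z, g z))"
    using assms by (rule continuous_map_pairedI)
  from continuous_map_compose[OF this continuous_mult] show ?thesis
    by (simp add: o_def)
qed

lemma continuous_map_minv:
  assumes "continuous_map Z T f"
  shows "continuous_map Z T (\<lambda>z. inv f z)"
  using continuous_map_compose[OF assms continuous_inv] by (simp add: o_def)

lemma continuous_map_pt: "x \<in> carrier G \<Longrightarrow> continuous_map Z T (\<lambda>_. x)"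
  by (simp add: topspace_eq_carrier)

lemmas continuous_intros_group = continuous_map_mult continuous_map_minv continuous_map_pt
  continuous_map_id[unfolded id_def]

lemma closedin_preimage:
  assumes "continuous_map T T f" "closedin T N"
  shows "closedin T {x \<in> carrier G. f x \<in> N}"
  using closedin_continuous_map_preimage[OF assms] by (simp add: topspace_eq_carrier)

lemma openin_preimage:
  assumes "continuous_map T T f" "openin T N"
  shows "openin T {x \<in> carrier G. f x \<in> N}"
  using openin_continuous_map_preimage[OF assms] by (simp add: topspace_eq_carrier)

lemma closedin_carrier: "closedin T (carrier G)"
  using closedin_topspace[of T] by (simp add: topspace_eq_carrier)

lemma closedin_sub_carrier: "closedin T A \<Longrightarrow> A \<subseteq> carrier G"
  by (metis closedin_subset topspace_eq_carrier)

lemma openin_sub_carrier: "openin T A \<Longrightarrow> A \<subseteq> carrier G"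
  by (metis openin_subset topspace_eq_carrier)

lemma closure_subset_carrier: "T closure_of A \<subseteq> carrier G"
  by (metis closure_of_subset_topspace topspace_eq_carrier)

lemma subset_closure: "A \<subseteq> carrier G \<Longrightarrow> A \<subseteq> T closure_of A"
  by (simp add: closure_of_subset topspace_eq_carrier)

text \<open>The closed condition \<open>f x y \<in> N\<close> is extended to closures one variable
  at a time, so that only preimages under maps from \<open>T\<close> to \<open>T\<close>
  occur.\<close>

lemma closedin_two_var:
  assumes N: "closedin T N" and A: "A \<subseteq> carrier G" and B: "B \<subseteq> carrier G"
    and cont1: "\<And>y. y \<in> carrier G \<Longrightarrow> continuous_map T T (\<lambda>x. f x y)"
    and cont2: "\<And>x. x \<in> carrier G \<Longrightarrow> continuous_map T T (\<lambda>y. f x y)"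
    and f: "\<And>x y. \<lbrakk>x \<in> A; y \<in> B\<rbrakk> \<Longrightarrow> f x y \<in> N"
    and x: "x \<in> T closure_of A" and y: "y \<in> T closure_of B"
  shows "f x y \<in> N"
proof -
  have 1: "f u v \<in> N" if "u \<in> T closure_of A" "v \<in> B" for u v
  proof -
    have "T closure_of A \<subseteq> {x \<in> carrier G. f x v \<in> N}"
      using that A B f by (intro closure_of_minimal closedin_preimage cont1 N) auto
    with that show ?thesis by blast
  qed
  have "x \<in> carrier G" using x closure_subset_carrier by blast
  then have "T closure_of B \<subseteq> {y \<in> carrier G. f x y \<in> N}"
    using x B 1 by (intro closure_of_minimal closedin_preimage cont2 N) auto
  with y show ?thesis by blast
qed

lemma subgroup_closure:
  assumes H: "subgroup H G"
  shows "subgroup (T closure_of H) G"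
proof (rule subgroupI)
  interpret H: subgroup H G by fact
  show "T closure_of H \<subseteq> carrier G" by (rule closure_subset_carrier)
  have sub: "H \<subseteq> T closure_of H" using subset_closure H.subset by blast
  then show "T closure_of H \<noteq> {}" using H.one_closed by blast
  have "T closure_of H \<subseteq> {x \<in> carrier G. inv x \<in> T closure_of H}"
    using sub by (intro closure_of_minimal closedin_preimage continuous_intros_group) auto
  then show "inv a \<in> T closure_of H" if "a \<in> T closure_of H" for a using that by blast
  show "a \<otimes> b \<in> T closure_of H" if "a \<in> T closure_of H" "b \<in> T closure_of H" for a b
    by (rule closedin_two_var[of "T closure_of H" H H "(\<otimes>)"])
      (use that sub in \<open>auto intro!: continuous_intros_group\<close>)
qed

abbreviation cgen :: "'a set \<Rightarrow> 'a set" where "cgen \<equiv> closed_generate G T"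

lemma closedin_cgen: "closedin T (cgen S)"
  by (simp add: closed_generate_def)

lemma subgroup_cgen: "S \<subseteq> carrier G \<Longrightarrow> subgroup (cgen S) G"
  unfolding closed_generate_def by (intro subgroup_closure generate_is_subgroup)

lemma cgen_superset: "S \<subseteq> carrier G \<Longrightarrow> S \<subseteq> cgen S"
  unfolding closed_generate_def using generate_sincl[of S] subset_closure[OF generate_incl] by blast

lemma cgen_least: "\<lbrakk>S \<subseteq> H; subgroup H G; closedin T H\<rbrakk> \<Longrightarrow> cgen S \<subseteq> H"
  unfolding closed_generate_def by (intro closure_of_minimal generate_subgroup_incl)

lemma cgen_mono: "S \<subseteq> S' \<Longrightarrow> cgen S \<subseteq> cgen S'"
  unfolding closed_generate_def by (intro closure_of_mono mono_generate)

lemma cgen_sub_carrier: "cgen S \<subseteq> carrier G"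
  unfolding closed_generate_def by (rule closure_subset_carrier)

lemma normal_cgen:
  assumes S: "S \<subseteq> carrier G"
    and conj: "\<And>g s. \<lbrakk>g \<in> carrier G; s \<in> S\<rbrakk> \<Longrightarrow> g \<otimes> s \<otimes> inv g \<in> S"
  shows "cgen S \<lhd> G"
proof -
  have gen: "generate G S \<lhd> G" by (rule normal_generateI[OF S conj])
  have "g \<otimes> x \<otimes> inv g \<in> cgen S" if g: "g \<in> carrier G" and x: "x \<in> cgen S" for g x
  proof -
    have sub: "generate G S \<subseteq> cgen S"
      unfolding closed_generate_def by (rule subset_closure[OF generate_incl[OF S]])
    have "generate G S \<subseteq> {x \<in> carrier G. g \<otimes> x \<otimes> inv g \<in> cgen S}"
      using sub normal.inv_op_closed2[OF gen g] generate_in_carrier[OF S] by blast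
    moreover have "closedin T {x \<in> carrier G. g \<otimes> x \<otimes> inv g \<in> cgen S}"
      using g by (intro closedin_preimage continuous_intros_group closedin_cgen) auto
    ultimately have "T closure_of (generate G S) \<subseteq> {x \<in> carrier G. g \<otimes> x \<otimes> inv g \<in> cgen S}"
      by (rule closure_of_minimal)
    then show ?thesis using x by (auto simp: closed_generate_def)
  qed
  then show ?thesis using subgroup_cgen[OF S] by (simp add: normal_inv_iff)
qed

text \<open>The \<open>x\<close> in \<open>M\<close> whose commutators with all of \<open>S'\<close>
  lie in \<open>N\<close> form a closed subgroup containing \<open>S\<close>, hence
  \<open>cgen S\<close>; the same argument in the second variable then reaches
  \<open>cgen S'\<close>.\<close>

lemma comm_cgen_mem:
  assumes M: "subgroup M G" "closedin T M" and N: "subgroup N G" "closedin T N" "normalizes M N"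
    and S: "S \<subseteq> M" "S' \<subseteq> M" and comm: "\<And>x y. \<lbrakk>x \<in> S; y \<in> S'\<rbrakk> \<Longrightarrow> comm x y \<in> N"
    and x: "x \<in> cgen S" and y: "y \<in> cgen S'"
  shows "comm x y \<in> N"
proof -
  have Mc: "M \<subseteq> carrier G" using M subgroup.subset by blast
  have cl: "closedin T {x \<in> M. \<forall>y\<in>Y. comm x y \<in> N}" if "Y \<subseteq> carrier G" for Y
  proof -
    have "{x \<in> M. \<forall>y\<in>Y. comm x y \<in> N} = \<Inter>(insert M ((\<lambda>y. {x \<in> carrier G. comm x y \<in> N}) ` Y))"
      using Mc by auto
    moreover have "closedin T {x \<in> carrier G. comm x y \<in> N}" if "y \<in> carrier G" for y
      using that unfolding comm_def by (intro closedin_preimage continuous_intros_group N) auto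
    ultimately show ?thesis using M(2) that by (simp only:) (rule closedin_Inter, auto)
  qed
  have cl': "closedin T {y \<in> M. \<forall>x\<in>Y. comm x y \<in> N}" if "Y \<subseteq> carrier G" for Y
  proof -
    have "{y \<in> M. \<forall>x\<in>Y. comm x y \<in> N} = {x \<in> M. \<forall>y\<in>Y. comm x y \<in> N}"
      using comm_mem_swap[OF N(1)] Mc that by blast
    then show ?thesis using cl[OF that] by simp
  qed
  have 1: "cgen S \<subseteq> {x \<in> M. \<forall>y\<in>S'. comm x y \<in> N}"
    using S comm Mc by (intro cgen_least comm_left_subgroup cl M N) auto
  have "cgen S' \<subseteq> {y \<in> M. \<forall>x\<in>cgen S. comm x y \<in> N}"
    using 1 S by (intro cgen_least comm_right_subgroup[OF M(1) N(1,3) cgen_sub_carrier] cl'[OF cgen_sub_carrier]) auto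
  then show ?thesis using x y by blast
qed

end

section \<open>Lower central series\<close>

context top_group
begin

lemma normal_subset: "N \<lhd> G \<Longrightarrow> N \<subseteq> carrier G"
  by (simp add: normal_imp_subgroup subgroup.subset)

lemma normalizes_normal: "N \<lhd> G \<Longrightarrow> normalizes (carrier G) N"
  by (simp add: normal_inv_iff normalizes_def)

lemma comm_cgen_normal:
  assumes "N \<lhd> G" "closedin T N" "S \<subseteq> carrier G" "S' \<subseteq> carrier G"
    and "\<And>x y. \<lbrakk>x \<in> S; y \<in> S'\<rbrakk> \<Longrightarrow> comm x y \<in> N" and "x \<in> cgen S" "y \<in> cgen S'"
  shows "comm x y \<in> N"
  by (rule comm_cgen_mem[OF subgroup_self closedin_carrier normal_imp_subgroup _ normalizes_normal])
    (use assms in auto)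

lemma comm_mem_normal:
  assumes N: "N \<lhd> G" and "x \<in> carrier G" "y \<in> carrier G" and xy: "x \<in> N \<or> y \<in> N"
  shows "comm x y \<in> N"
proof -
  interpret N: normal N G by fact
  have *: "comm u v \<in> N" if "u \<in> N" "v \<in> carrier G" for u v
  proof -
    have "comm u v = inv u \<otimes> (inv v \<otimes> u \<otimes> v)" using that by (simp add: comm_def m_assoc)
    then show ?thesis using that N.inv_op_closed1 by simp
  qed
  then show ?thesis using assms comm_mem_swap[OF N.subgroup_axioms] by blast
qed

text \<open>The index is shifted: \<open>gam i K\<close> is \<open>\<gamma>\<^sub>i\<^sub>+\<^sub>1(K)\<close>.\<close>

abbreviation gam :: "nat \<Rightarrow> 'a set \<Rightarrow> 'a set" where
  "gam i K \<equiv> lower_central G T (Suc i) K"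

lemma gam_Suc: "gam (Suc i) K = cgen {comm x y |x y. x \<in> gam i K \<and> y \<in> K}"
  by (simp add: closed_commutator_def comm_def)

declare lower_central.simps(3) [simp del]

lemma gam_sub_carrier: "K \<subseteq> carrier G \<Longrightarrow> gam i K \<subseteq> carrier G"
  by (cases i) (simp_all add: gam_Suc cgen_sub_carrier)

lemma closedin_gam: "closedin T K \<Longrightarrow> closedin T (gam i K)"
  by (cases i) (simp_all add: gam_Suc closedin_cgen)

lemma gam_comm:
  assumes "K \<subseteq> carrier G" "x \<in> gam i K" "y \<in> K"
  shows "comm x y \<in> gam (Suc i) K"
proof -
  have "{comm x y |x y. x \<in> gam i K \<and> y \<in> K} \<subseteq> carrier G"
    using assms(1) gam_sub_carrier[OF assms(1)] by blast
  from cgen_superset[OF this] show ?thesis unfolding gam_Suc using assms by blast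
qed

lemma gam_mono: "K \<subseteq> L \<Longrightarrow> gam i K \<subseteq> gam i L"
proof (induction i)
  case (Suc i)
  then show ?case unfolding gam_Suc by (intro cgen_mono) blast
qed simp

lemma normal_gam:
  assumes K: "K \<lhd> G"
  shows "gam i K \<lhd> G"
proof (induction i)
  case (Suc i)
  have sub: "K \<subseteq> carrier G" "gam i K \<subseteq> carrier G"
    using K Suc by (simp_all add: normal_subset)
  show ?case unfolding gam_Suc
  proof (rule normal_cgen)
    show "{comm x y |x y. x \<in> gam i K \<and> y \<in> K} \<subseteq> carrier G"
      using sub by blast
    fix g s assume g: "g \<in> carrier G" and "s \<in> {comm x y |x y. x \<in> gam i K \<and> y \<in> K}"
    then obtain x y where s: "s = comm x y" "x \<in> gam i K" "y \<in> K" by blast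
    have "g \<otimes> s \<otimes> inv g = comm (g \<otimes> x \<otimes> inv g) (g \<otimes> y \<otimes> inv g)"
      using s g sub by (simp add: conj_comm subsetD)
    moreover have "g \<otimes> x \<otimes> inv g \<in> gam i K" "g \<otimes> y \<otimes> inv g \<in> K"
      using s normal.inv_op_closed2[OF K g] normal.inv_op_closed2[OF Suc.IH g] by auto
    ultimately show "g \<otimes> s \<otimes> inv g \<in> {comm x y |x y. x \<in> gam i K \<and> y \<in> K}" by blast
  qed
qed (use K in simp)

lemma subgroup_gam: "K \<lhd> G \<Longrightarrow> subgroup (gam i K) G"
  using normal_gam normal_imp_subgroup by blast

lemma gam_Suc_subset:
  assumes K: "K \<lhd> G" "closedin T K"
  shows "gam (Suc i) K \<subseteq> gam i K"
proof -
  have "K \<subseteq> carrier G" using K closedin_sub_carrier by blast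
  then show ?thesis
    unfolding gam_Suc using comm_mem_normal[OF normal_gam[OF K(1)]] gam_sub_carrier
    by (intro cgen_least subgroup_gam closedin_gam K) blast
qed

lemma gam_antimono:
  assumes K: "K \<lhd> G" "closedin T K" and "i \<le> j"
  shows "gam j K \<subseteq> gam i K"
  using lift_Suc_antimono_le[of "\<lambda>i. gam i K", OF gam_Suc_subset[OF K] \<open>i \<le> j\<close>] by simp

text \<open>Allows a subgroup of finite index to be replaced by its closure. The closure on the
  right only matters at index 0, since the later terms are closed already.\<close>

lemma gam_closure:
  assumes K: "K \<subseteq> carrier G"
  shows "gam i (T closure_of K) \<subseteq> T closure_of (gam i K)"
proof (induction i)
  case (Suc i)
  have "gam (Suc i) (T closure_of K) \<subseteq> gam (Suc i) K"
    unfolding gam_Suc[of i "T closure_of K"]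
  proof (rule cgen_least)
    show cl: "closedin T (gam (Suc i) K)" unfolding gam_Suc by (rule closedin_cgen)
    show "subgroup (gam (Suc i) K) G" unfolding gam_Suc
      using K gam_sub_carrier[OF K] by (intro subgroup_cgen) blast
    have "comm x y \<in> gam (Suc i) K" if "x \<in> gam i (T closure_of K)" "y \<in> T closure_of K" for x y
    proof (rule closedin_two_var[OF cl gam_sub_carrier[OF K] K, where f = comm])
      show "continuous_map T T (\<lambda>x. comm x y)" if "y \<in> carrier G" for y
        using that unfolding comm_def by (intro continuous_intros_group) auto
      show "continuous_map T T (\<lambda>y. comm x y)" if "x \<in> carrier G" for x
        using that unfolding comm_def by (intro continuous_intros_group) auto
    qed (use that Suc gam_comm[OF K] in auto)
    then show "{comm x y |x y. x \<in> gam i (T closure_of K) \<and> y \<in> T closure_of K} \<subseteq> gam (Suc i) K"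
      by blast
  qed
  then show ?case using subset_closure[OF gam_sub_carrier[OF K]] by blast
qed simp

section \<open>Commutators in a product of two normal subgroups\<close>

lemma self_normal_carrier: "carrier G \<lhd> G"
  by (simp add: normal_inv_iff subgroup_self)

text \<open>Unshifted, with the convention \<open>\<gamma>\<^sub>0(K) = G\<close>, so that \<open>gam' a K\<close> contains every left-normed
  commutator with \<open>a\<close> entries in the normal subgroup \<open>K\<close>.\<close>

definition gam' :: "nat \<Rightarrow> 'a set \<Rightarrow> 'a set" where
  "gam' a K = (case a of 0 \<Rightarrow> carrier G | Suc i \<Rightarrow> gam i K)"

lemma normal_gam':
  assumes "K \<lhd> G" shows "gam' a K \<lhd> G"
  using assms normal_gam self_normal_carrier by (auto simp: gam'_def split: nat.split)

text \<open>The step from \<open>a = 0\<close> is where normality enters: the commutator of any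
  group element with an element of \<open>K\<close> lies in \<open>K\<close>.\<close>

lemma gam'_comm:
  assumes K: "K \<lhd> G" and x: "x \<in> gam' a K" "y \<in> K"
  shows "comm x y \<in> gam' (Suc a) K"
proof -
  have sub: "K \<subseteq> carrier G" using K by (rule normal_subset)
  show ?thesis
    using x comm_mem_normal[OF K] gam_comm[OF sub] sub
    by (cases a) (auto simp: gam'_def)
qed

text \<open>Bracketing with an element of \<open>K\<close> moves \<open>gam' a K\<close> to
  \<open>gam' (Suc a) K\<close>, bracketing with \<open>H\<close> does the same on the side of
  \<open>H\<close>, and normality preserves the other factor. So the two indices always add up to
  the weight \<open>Suc n\<close>.\<close>

lemma gam_product_subset:
  assumes K: "K \<lhd> G" and H: "H \<lhd> G" and M: "M \<subseteq> cgen (K \<union> H)"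
  shows "gam n M \<subseteq> cgen (\<Union>a\<le>Suc n. gam' a K \<inter> gam' (Suc n - a) H)"
proof (induction n)
  have sub: "gam' a K \<subseteq> carrier G" "gam' a H \<subseteq> carrier G" for a
    using K H by (simp_all add: normal_subset normal_gam')
  have KH: "K \<union> H \<subseteq> carrier G" using sub[of "Suc 0"] by (simp add: gam'_def)
  {
    case 0
    have "K \<union> H \<subseteq> (\<Union>a\<le>Suc 0. gam' a K \<inter> gam' (Suc 0 - a) H)"
      using KH by (auto simp: gam'_def atMost_Suc)
    then have "cgen (K \<union> H) \<subseteq> cgen (\<Union>a\<le>Suc 0. gam' a K \<inter> gam' (Suc 0 - a) H)"
      by (rule cgen_mono)
    then show ?case unfolding lower_central.simps(2) using M by (rule subset_trans[rotated])
  next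
    case (Suc n)
    let ?S = "\<lambda>n. \<Union>a\<le>Suc n. gam' a K \<inter> gam' (Suc n - a) H"
    have S: "?S k \<subseteq> carrier G" for k using sub by blast
    have norm: "cgen (?S (Suc n)) \<lhd> G"
    proof (rule normal_cgen[OF S])
      fix g s assume g: "g \<in> carrier G" and "s \<in> ?S (Suc n)"
      then obtain a where a: "a \<le> Suc (Suc n)" "s \<in> gam' a K" "s \<in> gam' (Suc (Suc n) - a) H"
        by blast
      have "g \<otimes> s \<otimes> inv g \<in> gam' a K" "g \<otimes> s \<otimes> inv g \<in> gam' (Suc (Suc n) - a) H"
        using a by (simp_all add: normal.inv_op_closed2[OF normal_gam'[OF K] g]
            normal.inv_op_closed2[OF normal_gam'[OF H] g])
      with a show "g \<otimes> s \<otimes> inv g \<in> ?S (Suc n)" by blast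
    qed
    have gen: "comm x y \<in> cgen (?S (Suc n))" if x: "x \<in> ?S n" and y: "y \<in> K \<union> H" for x y
    proof -
      obtain a where a: "a \<le> Suc n" "x \<in> gam' a K" "x \<in> gam' (Suc n - a) H" using x by blast
      have xc: "x \<in> carrier G" "y \<in> carrier G" using a sub y KH by blast+
      from y have "comm x y \<in> ?S (Suc n)"
      proof
        assume "y \<in> K"
        then have "comm x y \<in> gam' (Suc a) K" "comm x y \<in> gam' (Suc (Suc n) - Suc a) H"
          using a gam'_comm[OF K] comm_mem_normal[OF normal_gam'[OF H]] xc by auto
        with a show ?thesis by blast
      next
        assume "y \<in> H"
        then have "comm x y \<in> gam' a K" "comm x y \<in> gam' (Suc (Suc n) - a) H"
          using a gam'_comm[OF H] comm_mem_normal[OF normal_gam'[OF K]] xc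
          by (auto simp: Suc_diff_le)
        with a show ?thesis by (meson UN_I IntI atMost_iff le_SucI)
      qed
      with cgen_superset[OF S] show ?thesis by blast
    qed
    show ?case unfolding gam_Suc[of n M]
    proof (rule cgen_least)
      show "{comm x y |x y. x \<in> gam n M \<and> y \<in> M} \<subseteq> cgen (?S (Suc n))"
        using comm_cgen_normal[OF norm closedin_cgen S KH gen] Suc M by blast
    qed (use norm normal_imp_subgroup closedin_cgen in auto)
  }
qed

lemma gam_double_subset:
  assumes K: "K \<lhd> G" "closedin T K" and H: "H \<lhd> G" "closedin T H" "gam c H \<subseteq> {\<one>}"
    and M: "M \<subseteq> cgen (K \<union> H)"
  shows "gam (2 * c) M \<subseteq> gam c K"
proof -
  have "gam' a K \<inter> gam' (Suc (2 * c) - a) H \<subseteq> gam c K" for a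
  proof (cases "a \<le> c")
    case True
    \<comment> \<open>The index \<open>j = 2 * c - a\<close> accounts for the shift in
      \<open>gam'\<close>: \<open>gam' (Suc j) H\<close> is \<open>gam j H\<close>, which is trivial
      as soon as \<open>c \<le> j\<close>.\<close>
    then obtain j where j: "Suc (2 * c) - a = Suc j" "c \<le> j"
      by (intro that[of "2 * c - a"]) auto
    then have "gam' (Suc (2 * c) - a) H \<subseteq> {\<one>}"
      using gam_antimono[OF H(1,2) j(2)] H(3) by (auto simp: gam'_def)
    then show ?thesis using subgroup.one_closed[OF subgroup_gam[OF K(1)]] by blast
  next
    case False
    then obtain j where "a = Suc j" "c \<le> j" by (cases a) auto
    then show ?thesis using gam_antimono[OF K] by (auto simp: gam'_def)
  qed
  then have "cgen (\<Union>a\<le>Suc (2 * c). gam' a K \<inter> gam' (Suc (2 * c) - a) H) \<subseteq> gam c K"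
    by (intro cgen_least subgroup_gam closedin_gam K) blast
  with gam_product_subset[OF K(1) H(1) M] show ?thesis by blast
qed

end

section \<open>Open subgroups\<close>

context top_group
begin

lemma closedin_finite_cosets:
  assumes "finite F" "F \<subseteq> carrier G" "closedin T N"
  shows "closedin T {x \<in> carrier G. \<exists>f\<in>F. inv f \<otimes> x \<in> N}"
proof -
  have "{x \<in> carrier G. \<exists>f\<in>F. inv f \<otimes> x \<in> N} = (\<Union>f\<in>F. {x \<in> carrier G. inv f \<otimes> x \<in> N})"
    by blast
  moreover have "closedin T {x \<in> carrier G. inv f \<otimes> x \<in> N}" if "f \<in> F" for f
    using that assms by (intro closedin_preimage continuous_intros_group) auto
  ultimately show ?thesis using assms(1) by (auto intro!: closedin_Union)
qed

text \<open>A finite union of translates of the closed set \<open>N\<close> is closed, so translates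
  covering \<open>A\<close> also cover its closure.\<close>

lemma fin_index_closure:
  assumes "fin_index A N" "closedin T N" "A \<subseteq> carrier G"
  shows "fin_index (T closure_of A) N"
proof -
  obtain F where F: "finite F" "F \<subseteq> carrier G" "\<forall>a\<in>A. \<exists>f\<in>F. inv f \<otimes> a \<in> N"
    using assms(1) unfolding fin_index_def by blast
  have "T closure_of A \<subseteq> {x \<in> carrier G. \<exists>f\<in>F. inv f \<otimes> x \<in> N}"
    using F assms(3) by (intro closure_of_minimal closedin_finite_cosets F assms) auto
  then show ?thesis unfolding fin_index_def using F(1,2) by blast
qed

section \<open>Open subgroups, cosets and normal cores\<close>

lemma openin_coset:
  assumes "openin T U" "x \<in> carrier G"
  shows "openin T {z \<in> carrier G. inv x \<otimes> z \<in> U}"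
  using assms by (intro openin_preimage continuous_intros_group) auto

lemma openin_supergroup:
  assumes U: "subgroup U G" "openin T U" and M: "subgroup M G" "U \<subseteq> M"
  shows "openin T M"
proof -
  interpret U: subgroup U G by fact
  interpret M: subgroup M G by fact
  have "M = (\<Union>x\<in>M. {z \<in> carrier G. inv x \<otimes> z \<in> U})"
  proof (intro equalityI subsetI)
    fix z assume "z \<in> (\<Union>x\<in>M. {z \<in> carrier G. inv x \<otimes> z \<in> U})"
    then obtain x where x: "x \<in> M" "z \<in> carrier G" "inv x \<otimes> z \<in> U" by blast
    then have "x \<otimes> (inv x \<otimes> z) \<in> M" using M by blast
    then show "z \<in> M" using x by (simp add: group_simps)
  next
    fix z assume "z \<in> M"
    then show "z \<in> (\<Union>x\<in>M. {z \<in> carrier G. inv x \<otimes> z \<in> U})"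
      by (intro UN_I[of z]) auto
  qed
  moreover have "openin T (\<Union>x\<in>M. {z \<in> carrier G. inv x \<otimes> z \<in> U})"
    using openin_coset[OF U(2)] by auto
  ultimately show ?thesis by simp
qed

lemma closedin_open_subgroup:
  assumes U: "subgroup U G" "openin T U"
  shows "closedin T U"
proof -
  interpret U: subgroup U G by fact
  have "carrier G - U = (\<Union>x\<in>carrier G - U. {z \<in> carrier G. inv x \<otimes> z \<in> U})"
  proof (intro equalityI subsetI)
    fix z assume "z \<in> (\<Union>x\<in>carrier G - U. {z \<in> carrier G. inv x \<otimes> z \<in> U})"
    then obtain x where x: "x \<in> carrier G" "x \<notin> U" "z \<in> carrier G" "inv x \<otimes> z \<in> U" by blast
    have "z \<otimes> inv (inv x \<otimes> z) \<in> U" if "z \<in> U" using that x by blast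
    moreover have "z \<otimes> inv (inv x \<otimes> z) = x" using x by (simp add: group_simps)
    ultimately show "z \<in> carrier G - U" using x by auto
  next
    fix z assume "z \<in> carrier G - U"
    then show "z \<in> (\<Union>x\<in>carrier G - U. {z \<in> carrier G. inv x \<otimes> z \<in> U})"
      by (intro UN_I[of z]) auto
  qed
  moreover have "openin T (\<Union>x\<in>carrier G - U. {z \<in> carrier G. inv x \<otimes> z \<in> U})"
    using openin_coset[OF U(2)] by auto
  ultimately show ?thesis using U.subset by (simp add: closedin_def topspace_eq_carrier)
qed

text \<open>The complement of \<open>U\<close> is a finite union of closed left cosets
  \<open>f U\<close> with \<open>f\<close> outside \<open>U\<close>.\<close>

lemma openin_closed_fin_index:
  assumes U: "subgroup U G" "closedin T U" and fin: "fin_index (carrier G) U"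
  shows "openin T U"
proof -
  interpret U: subgroup U G by fact
  obtain F where F: "finite F" "F \<subseteq> carrier G" "\<forall>a\<in>carrier G. \<exists>f\<in>F. inv f \<otimes> a \<in> U"
    using fin unfolding fin_index_def by blast
  have "carrier G - U = {x \<in> carrier G. \<exists>f\<in>F - U. inv f \<otimes> x \<in> U}"
  proof (intro equalityI subsetI)
    fix z assume z: "z \<in> carrier G - U"
    then obtain f where f: "f \<in> F" "inv f \<otimes> z \<in> U" using F by blast
    have "f \<otimes> (inv f \<otimes> z) \<in> U" if "f \<in> U" using that f by blast
    moreover have "f \<otimes> (inv f \<otimes> z) = z" using f z F by (simp add: group_simps subsetD)
    ultimately show "z \<in> {x \<in> carrier G. \<exists>f\<in>F - U. inv f \<otimes> x \<in> U}" using f z by auto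
  next
    fix z assume "z \<in> {x \<in> carrier G. \<exists>f\<in>F - U. inv f \<otimes> x \<in> U}"
    then obtain f where f: "f \<in> F" "f \<notin> U" "z \<in> carrier G" "inv f \<otimes> z \<in> U" by blast
    have "z \<otimes> inv (inv f \<otimes> z) \<in> U" if "z \<in> U" using that f by blast
    moreover have "z \<otimes> inv (inv f \<otimes> z) = f" using f F by (simp add: group_simps subsetD)
    ultimately show "z \<in> carrier G - U" using f by auto
  qed
  moreover have "closedin T {x \<in> carrier G. \<exists>f\<in>F - U. inv f \<otimes> x \<in> U}"
    using F U by (intro closedin_finite_cosets) auto
  ultimately have "closedin T (carrier G - U)" by simp
  then show ?thesis by (simp add: openin_closedin_eq topspace_eq_carrier U.subset)
qed

lemma open_normal_core:
  assumes U: "subgroup U G" "openin T U" and fin: "fin_index (carrier G) U"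
  shows "\<exists>N. N \<lhd> G \<and> openin T N \<and> N \<subseteq> U"
proof -
  interpret U: subgroup U G by fact
  obtain F where F: "finite F" "F \<subseteq> carrier G" "\<forall>a\<in>carrier G. \<exists>f\<in>F. inv f \<otimes> a \<in> U"
    using fin unfolding fin_index_def by blast
  define N where "N = {x \<in> carrier G. \<forall>g\<in>carrier G. inv g \<otimes> x \<otimes> g \<in> U}"
  \<comment> \<open>The conjugate of \<open>U\<close> by \<open>g\<close> depends only on the left
    coset of \<open>g\<close>, so the representatives in \<open>F\<close> suffice; this makes
    \<open>N\<close> a finite intersection of open sets.\<close>
  have NF: "x \<in> N" if x: "x \<in> carrier G" "\<And>f. f \<in> F \<Longrightarrow> inv f \<otimes> x \<otimes> f \<in> U" for x
  proof -
    have "inv g \<otimes> x \<otimes> g \<in> U" if g: "g \<in> carrier G" for g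
    proof -
      obtain f where f: "f \<in> F" "inv f \<otimes> g \<in> U" using F g by blast
      have fc: "f \<in> carrier G" using f F by blast
      have "inv (inv f \<otimes> g) \<otimes> (inv f \<otimes> x \<otimes> f) \<otimes> (inv f \<otimes> g) \<in> U"
        using f x(2)[OF f(1)] by blast
      then show ?thesis using fc g x by (simp add: group_simps)
    qed
    with x show ?thesis by (simp add: N_def)
  qed
  have "N = \<Inter>(insert (carrier G) ((\<lambda>f. {x \<in> carrier G. inv f \<otimes> x \<otimes> f \<in> U}) ` F))"
    using NF F(2) by (auto simp: N_def)
  moreover have "openin T {x \<in> carrier G. inv f \<otimes> x \<otimes> f \<in> U}" if "f \<in> F" for f
    using that F(2) by (intro openin_preimage continuous_intros_group U) auto
  ultimately have "openin T N"
    using F(1) openin_topspace[of T] unfolding topspace_eq_carrier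
    by (simp only:) (rule openin_Inter, auto)
  moreover have "N \<subseteq> U" by (force simp: N_def)
  moreover have "subgroup N G"
  proof (rule subgroupI)
    show "N \<subseteq> carrier G" by (auto simp: N_def)
    have "\<one> \<in> N" by (simp add: N_def)
    then show "N \<noteq> {}" by blast
    fix a assume a: "a \<in> N"
    have "inv g \<otimes> inv a \<otimes> g \<in> U" if g: "g \<in> carrier G" for g
    proof -
      have "inv (inv g \<otimes> a \<otimes> g) \<in> U" using a g by (auto simp: N_def)
      then show ?thesis using a g by (simp add: group_simps N_def)
    qed
    then show "inv a \<in> N" using a by (simp add: N_def)
    fix b assume b: "b \<in> N"
    have "inv g \<otimes> (a \<otimes> b) \<otimes> g \<in> U" if g: "g \<in> carrier G" for g
    proof -
      have "(inv g \<otimes> a \<otimes> g) \<otimes> (inv g \<otimes> b \<otimes> g) \<in> U" using a b g by (auto simp: N_def)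
      then show ?thesis using a b g by (simp add: group_simps N_def)
    qed
    then show "a \<otimes> b \<in> N" using a b by (simp add: N_def)
  qed
  moreover have "x \<otimes> h \<otimes> inv x \<in> N" if x: "x \<in> carrier G" and h: "h \<in> N" for x h
  proof -
    have "inv g \<otimes> (x \<otimes> h \<otimes> inv x) \<otimes> g \<in> U" if g: "g \<in> carrier G" for g
    proof -
      have "inv (inv x \<otimes> g) \<otimes> h \<otimes> (inv x \<otimes> g) \<in> U" using x h g by (auto simp: N_def)
      then show ?thesis using x h g by (simp add: group_simps N_def)
    qed
    then show ?thesis using x h by (simp add: N_def)
  qed
  ultimately show ?thesis unfolding normal_inv_iff by blast
qed

lemma open_normal_finite_inter:
  assumes "finite I" "\<And>K. K \<in> I \<Longrightarrow> K \<lhd> G \<and> openin T K"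
  shows "\<exists>N. N \<lhd> G \<and> openin T N \<and> (\<forall>K\<in>I. N \<subseteq> K)"
  using assms
proof (induction I)
  case empty
  show ?case using self_normal_carrier openin_topspace[of T] by (auto simp: topspace_eq_carrier)
next
  case (insert K I)
  then obtain N where N: "N \<lhd> G" "openin T N" "\<forall>K\<in>I. N \<subseteq> K" by auto
  have K: "K \<lhd> G" "openin T K" using insert.prems by auto
  have "N \<inter> K \<lhd> G"
    using N(1) K(1) subgroups_Inter_pair unfolding normal_inv_iff by auto
  moreover have "openin T (N \<inter> K)" using N K by blast
  moreover have "\<forall>L\<in>insert K I. N \<inter> K \<subseteq> L" using N(3) by auto
  ultimately show ?case by blast
qed

text \<open>A topological version of Schreier's lemma: for a finite set \<open>R \<ni> \<one>\<close> with \<open>G = M R\<close>, the subgroup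
  \<open>M\<close> is topologically generated by its elements in \<open>R\<close> and of the form \<open>t s t'\<^sup>-\<^sup>1\<close> with \<open>t, t' \<in> R\<close>
  and \<open>s\<close> a generator or the inverse of one.\<close>

lemma open_subgroup_fin_gen:
  assumes S: "finite S" "S \<subseteq> carrier G" "cgen S = carrier G"
    and M: "subgroup M G" "openin T M" and fin: "fin_index (carrier G) M"
  shows "\<exists>Y. finite Y \<and> Y \<subseteq> M \<and> cgen Y = M"
proof -
  interpret M: subgroup M G by fact
  obtain F where F: "finite F" "F \<subseteq> carrier G" "\<forall>a\<in>carrier G. \<exists>f\<in>F. inv f \<otimes> a \<in> M"
    using fin unfolding fin_index_def by blast
  \<comment> \<open>Inversion turns left coset representatives into representatives of the right
    cosets \<open>M t\<close>; adding \<open>\<one>\<close> serves to put \<open>\<one>\<close> into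
    \<open>W\<close> below.\<close>
  define R where "R = insert \<one> (m_inv G ` F)"
  have Rc: "finite R" "R \<subseteq> carrier G" "\<one> \<in> R" using F by (auto simp: R_def)
  have R: "\<exists>t\<in>R. a \<otimes> inv t \<in> M" if a: "a \<in> carrier G" for a
  proof -
    obtain f where f: "f \<in> F" "inv f \<otimes> inv a \<in> M" using F a by (meson inv_closed)
    have "inv (inv f \<otimes> inv a) \<in> M" using f by blast
    then have "a \<otimes> inv (inv f) \<in> M" using f F a by (simp add: group_simps subsetD)
    then show ?thesis using f by (auto simp: R_def)
  qed
  define S' where "S' = S \<union> m_inv G ` S"
  have S': "finite S'" "S' \<subseteq> carrier G" using S by (auto simp: S'_def)
  define Y where "Y = M \<inter> ((\<lambda>(t, s, t'). t \<otimes> s \<otimes> inv t') ` (R \<times> S' \<times> R) \<union> R)"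
  have Y: "finite Y" "Y \<subseteq> M" using Rc S' by (auto simp: Y_def)
  have Yc: "Y \<subseteq> carrier G" using Y by auto
  have closedM: "closedin T M" by (rule closedin_open_subgroup[OF M])
  have UM: "cgen Y \<subseteq> M" by (rule cgen_least[OF Y(2) M(1) closedM])
  have YU: "Y \<subseteq> cgen Y" by (rule cgen_superset[OF Yc])
  interpret U: subgroup "cgen Y" G by (rule subgroup_cgen[OF Yc])
  \<comment> \<open>\<open>W\<close> is the product of \<open>cgen Y\<close> and \<open>R\<close>.
    It contains \<open>\<one>\<close>, is stable under right multiplication by \<open>S'\<close>,
    and is closed because \<open>R\<close> is finite, so it is all of \<open>G\<close>.\<close>
  define W where "W = {a \<in> carrier G. \<exists>t\<in>R. a \<otimes> inv t \<in> cgen Y}"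
  have step: "a \<otimes> s \<in> W" if a: "a \<in> W" and s: "s \<in> S'" for a s
  proof -
    obtain t where t: "t \<in> R" "a \<otimes> inv t \<in> cgen Y" and ac: "a \<in> carrier G"
      using a by (auto simp: W_def)
    have c: "t \<in> carrier G" "s \<in> carrier G" using t s Rc S' by auto
    obtain t' where t': "t' \<in> R" "(t \<otimes> s) \<otimes> inv t' \<in> M" using R c by blast
    have c': "t' \<in> carrier G" using t' Rc by auto
    have "t \<otimes> s \<otimes> inv t' \<in> Y" unfolding Y_def using t t' s by force
    then have "(a \<otimes> inv t) \<otimes> (t \<otimes> s \<otimes> inv t') \<in> cgen Y" using t YU by blast
    then have "(a \<otimes> s) \<otimes> inv t' \<in> cgen Y" using c c' ac by (simp add: group_simps)
    then show ?thesis using t' ac c by (auto simp: W_def)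
  qed
  have gen: "\<forall>a\<in>W. a \<otimes> g \<in> W" if "g \<in> generate G S" for g
    using that
  proof (induction g rule: generate.induct)
    case (eng g h)
    have "g \<in> carrier G" "h \<in> carrier G" using eng.hyps generate_in_carrier[OF S(2)] by auto
    then show ?case using eng.IH by (auto simp: W_def m_assoc[symmetric])
  qed (use step in \<open>auto simp: S'_def W_def\<close>)
  have "\<one> \<in> W" unfolding W_def using Rc(3) U.one_closed
    by (intro CollectI conjI bexI[of _ \<one>]) auto
  then have "generate G S \<subseteq> W"
    using gen generate_in_carrier[OF S(2)] by (metis l_one subsetI)
  moreover have "closedin T W"
  proof -
    have "W = (\<Union>t\<in>R. {a \<in> carrier G. a \<otimes> inv t \<in> cgen Y})" by (auto simp: W_def)
    moreover have "closedin T {a \<in> carrier G. a \<otimes> inv t \<in> cgen Y}" if "t \<in> R" for t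
      using that Rc by (intro closedin_preimage continuous_intros_group closedin_cgen) auto
    ultimately show ?thesis using Rc(1) by (auto intro!: closedin_Union)
  qed
  ultimately have "cgen S \<subseteq> W" unfolding closed_generate_def by (rule closure_of_minimal)
  \<comment> \<open>If \<open>m\<close> in \<open>M\<close> has \<open>m \<otimes> inv t\<close> in
    \<open>cgen Y\<close>, then \<open>t\<close> lies in \<open>M\<close>; for this reason the
    elements of \<open>R\<close> inside \<open>M\<close> were put into \<open>Y\<close>.\<close>
  have "M \<subseteq> cgen Y"
  proof
    fix m assume m: "m \<in> M"
    then have "m \<in> cgen S" using S(3) by simp
    then have "m \<in> W" using \<open>cgen S \<subseteq> W\<close> by blast
    then obtain t where t: "t \<in> R" "m \<otimes> inv t \<in> cgen Y" by (auto simp: W_def)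
    have c: "t \<in> carrier G" using t Rc by auto
    have "inv (m \<otimes> inv t) \<otimes> m \<in> M" using t UM m by blast
    then have "t \<in> M" using c m by (simp add: group_simps)
    then have "t \<in> cgen Y" using t YU by (auto simp: Y_def)
    then have "(m \<otimes> inv t) \<otimes> t \<in> cgen Y" using t by blast
    then show "m \<in> cgen Y" using c m by (simp add: group_simps)
  qed
  with UM Y show ?thesis by blast
qed

section \<open>Finiteness of lower central factors\<close>

text \<open>Torsion is measured relative to \<open>gam i H\<close> as well as the next term, which
  lets the induction start at \<open>i = 0\<close> from the assumption on \<open>Y\<close>. The new
  generators are commutators of old ones with elements of \<open>Y\<close>; they suffice because
  commutation is bimultiplicative modulo the next term.\<close>

lemma gam_torsion_generators:
  assumes M: "M \<lhd> G" "closedin T M" and H: "H \<lhd> G" "closedin T H" "H \<subseteq> M"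
    and Y: "finite Y" "Y \<subseteq> M" "M \<subseteq> cgen Y"
    and tors: "\<And>y. y \<in> Y \<Longrightarrow> \<exists>n>0. y [^] (n::nat) \<in> H"
  shows "\<exists>S. finite S \<and> S \<subseteq> gam i M \<and> gam i M \<subseteq> cgen (S \<union> gam (Suc i) M) \<and>
    (\<forall>x\<in>S. \<exists>n>0. x [^] (n::nat) \<in> cgen (gam i H \<union> gam (Suc i) M))"
proof (induction i)
  have Mc: "M \<subseteq> carrier G" and Hc: "H \<subseteq> carrier G" using M H by (simp_all add: normal_subset)
  have gc: "gam i M \<subseteq> carrier G" "gam i H \<subseteq> carrier G" for i
    using Mc Hc gam_sub_carrier by blast+
  have gM: "gam i M \<subseteq> M" for i using gam_antimono[OF M, of 0 i] by simp
  {
    case 0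
    have "M \<subseteq> cgen (Y \<union> gam (Suc 0) M)" using Y(3) cgen_mono[of Y "Y \<union> gam (Suc 0) M"] by blast
    moreover have "H \<subseteq> cgen (H \<union> gam (Suc 0) M)"
      using cgen_superset[of "H \<union> gam (Suc 0) M"] Hc gc by blast
    ultimately show ?case using Y tors by (intro exI[of _ Y]) (auto; blast)
  next
    case (Suc i)
    then obtain S where S: "finite S" "S \<subseteq> gam i M" "gam i M \<subseteq> cgen (S \<union> gam (Suc i) M)"
      and St: "\<And>x. x \<in> S \<Longrightarrow> \<exists>n>0. x [^] (n::nat) \<in> cgen (gam i H \<union> gam (Suc i) M)" by blast
    define S' where "S' = (\<lambda>(x, y). comm x y) ` (S \<times> Y)"
    have SY: "comm x y \<in> gam (Suc i) M" if "x \<in> S" "y \<in> Y" for x y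
      by (rule gam_comm[OF Mc]) (use that S Y in auto)
    then have S': "finite S'" "S' \<subseteq> gam (Suc i) M"
      using S Y by (auto simp: S'_def)
    define N where "N = cgen (S' \<union> gam (Suc (Suc i)) M)"
    have Nsub: "S' \<union> gam (Suc (Suc i)) M \<subseteq> carrier G" using S' gc by blast
    have N: "subgroup N G" "closedin T N" "S' \<subseteq> N" "gam (Suc (Suc i)) M \<subseteq> N"
      using subgroup_cgen[OF Nsub] closedin_cgen cgen_superset[OF Nsub] by (auto simp: N_def)
    have NM: "N \<subseteq> gam (Suc i) M" unfolding N_def
      using S' gam_Suc_subset[OF M] by (intro cgen_least subgroup_gam closedin_gam M) blast
    \<comment> \<open>\<open>S'\<close> has no invariance of its own. Conjugating \<open>n\<close>
      by \<open>g\<close> multiplies it by \<open>comm n (inv g)\<close>, which lies in the next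
      term of the series and so in \<open>N\<close>.\<close>
    have normN: "normalizes M N"
      unfolding normalizes_def
    proof (intro ballI)
      fix g n assume g: "g \<in> M" and n: "n \<in> N"
      have c: "g \<in> carrier G" "n \<in> carrier G" using g n Mc N subgroup.subset by blast+
      have "inv g \<in> M" using g M(1) normal_imp_subgroup subgroup.m_inv_closed by metis
      then have "comm n (inv g) \<in> N"
        using gam_comm[OF Mc, of n "Suc i" "inv g"] n NM N(4) by blast
      then have "n \<otimes> comm n (inv g) \<in> N" using n N by (simp add: subgroup.m_closed)
      moreover have "n \<otimes> comm n (inv g) = g \<otimes> n \<otimes> inv g" using c by (simp add: comm_def group_simps)
      ultimately show "g \<otimes> n \<otimes> inv g \<in> N" by simp
    qed
    have base: "comm x y \<in> N" if "x \<in> S \<union> gam (Suc i) M" "y \<in> Y" for x y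
      using that(1)
    proof
      assume "x \<in> S"
      then have "comm x y \<in> S'" using that(2) by (force simp: S'_def)
      then show ?thesis using N(3) by blast
    next
      assume "x \<in> gam (Suc i) M"
      then show ?thesis using gam_comm[OF Mc, of x "Suc i" y] that(2) Y(2) N(4) by blast
    qed
    have SM: "S \<union> gam (Suc i) M \<subseteq> M" using S gM by blast
    \<comment> \<open>Generators suffice here: \<open>gam i M\<close> is topologically generated by
      \<open>S\<close> and the next term, and \<open>M\<close> by \<open>Y\<close>.\<close>
    have "comm x y \<in> N" if "x \<in> gam i M" "y \<in> M" for x y
      by (rule comm_cgen_mem[OF normal_imp_subgroup[OF M(1)] M(2) N(1,2) normN SM Y(2) base])
        (use that S Y in auto)
    then have "gam (Suc i) M \<subseteq> N"
      unfolding gam_Suc[of i M] by (intro cgen_least N) blast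
    moreover have "\<exists>n>0. z [^] (n::nat) \<in> cgen (gam (Suc i) H \<union> gam (Suc (Suc i)) M)"
      if zS: "z \<in> S'" for z
    proof -
      let ?R = "cgen (gam (Suc i) H \<union> gam (Suc (Suc i)) M)"
      obtain x y where z: "z = comm x y" "x \<in> S" "y \<in> Y" using zS by (auto simp: S'_def)
      obtain a where a: "a > 0" "x [^] (a::nat) \<in> cgen (gam i H \<union> gam (Suc i) M)"
        using St z by blast
      obtain b where b: "b > 0" "y [^] (b::nat) \<in> H" using tors z by blast
      have xM: "x \<in> gam i M" "x \<in> M" "y \<in> M" using z S gM Y by blast+
      have Rc: "gam (Suc i) H \<union> gam (Suc (Suc i)) M \<subseteq> carrier G" using gc by blast
      have R: "?R \<lhd> G"
      proof (rule normal_cgen[OF Rc])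
        fix g s assume g: "g \<in> carrier G" and "s \<in> gam (Suc i) H \<union> gam (Suc (Suc i)) M"
        then show "g \<otimes> s \<otimes> inv g \<in> gam (Suc i) H \<union> gam (Suc (Suc i)) M"
          using normal.inv_op_closed2[OF normal_gam[OF H(1)] g]
            normal.inv_op_closed2[OF normal_gam[OF M(1)] g] by auto
      qed
      have sub: "gam (Suc i) H \<subseteq> ?R" "gam (Suc (Suc i)) M \<subseteq> ?R"
        using cgen_superset[OF Rc] by blast+
      have zM: "comm x y \<in> gam (Suc i) M" by (rule gam_comm[OF Mc xM(1,3)])
      have "comm x y [^] (a * b) \<in> ?R"
      proof (rule comm_pow_mem_normal[OF R])
        show "comm (comm x y) x \<in> ?R" "comm (comm x y) y \<in> ?R"
          using gam_comm[OF Mc zM] xM sub by blast+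
        \<comment> \<open>Bracketing with \<open>H\<close> sends \<open>gam i H\<close> into
          \<open>gam (Suc i) H\<close> and, as \<open>H\<close> is contained in \<open>M\<close>,
          sends \<open>gam (Suc i) M\<close> into the term after it. This treats the generators of
          the subgroup containing \<open>x [^] a\<close>.\<close>
        show "comm (x [^] a) (y [^] b) \<in> ?R"
        proof (rule comm_cgen_normal[OF R closedin_cgen _ Hc _ a(2)])
          show "gam i H \<union> gam (Suc i) M \<subseteq> carrier G" using gc by blast
          show "y [^] b \<in> cgen H" using b cgen_superset[OF Hc] by blast
          show "comm u v \<in> ?R" if "u \<in> gam i H \<union> gam (Suc i) M" "v \<in> H" for u v
            using that gam_comm[OF Hc] gam_comm[OF Mc] H(3) sub by blast
        qed
      qed (use xM Mc in auto)
      then show ?thesis using a b z by (intro exI[of _ "a * b"]) simp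
    qed
    ultimately show ?case using S' unfolding N_def by blast
  }
qed

text \<open>Each factor from index \<open>c\<close> on is abelian and topologically generated by
  finitely many torsion elements; finite index is then chained through \<open>k\<close>
  factors.\<close>

lemma fin_index_gam:
  assumes M: "M \<lhd> G" "closedin T M" and H: "H \<lhd> G" "closedin T H" "H \<subseteq> M"
    and Y: "finite Y" "Y \<subseteq> M" "M \<subseteq> cgen Y"
    and tors: "\<And>y. y \<in> Y \<Longrightarrow> \<exists>n>0. y [^] (n::nat) \<in> H"
    and nil: "gam c H \<subseteq> {\<one>}"
  shows "fin_index (gam c M) (gam (c + k) M)"
proof (induction k)
  have Mc: "M \<subseteq> carrier G" using M by (simp add: normal_subset)
  have gc: "gam i M \<subseteq> carrier G" for i by (rule gam_sub_carrier[OF Mc])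
  have gM: "gam i M \<subseteq> M" for i using gam_antimono[OF M, of 0 i] by simp
  {
    case 0
    show ?case unfolding fin_index_def using subsetD[OF gc[of c]]
      by (intro exI[of _ "{\<one>}"]) auto
  next
    case (Suc k)
    let ?A = "gam (c + k) M" and ?N = "gam (Suc (c + k)) M"
    obtain S where S: "finite S" "S \<subseteq> ?A" "?A \<subseteq> cgen (S \<union> ?N)"
      and tors': "\<And>x. x \<in> S \<Longrightarrow> \<exists>n>0. x [^] (n::nat) \<in> cgen (gam (c + k) H \<union> ?N)"
      using gam_torsion_generators[OF M H Y tors, of "c + k"] by blast
    have N: "subgroup ?N G" "closedin T ?N" using M by (simp_all only: subgroup_gam closedin_gam)
    \<comment> \<open>From index \<open>c\<close> on the contribution of \<open>H\<close> is
      trivial, so the generators are torsion modulo \<open>?N\<close> itself.\<close>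
    have "gam (c + k) H \<subseteq> ?N"
      using nil gam_antimono[OF H(1,2), of c "c + k"] subgroup.one_closed[OF N(1)] by auto
    then have "cgen (gam (c + k) H \<union> ?N) \<subseteq> ?N"
      by (intro cgen_least N) blast
    then have tors'': "\<exists>n>0. x [^] (n::nat) \<in> ?N" if "x \<in> S" for x
      using tors'[OF that] by blast
    have ab: "comm a b \<in> ?N" if "a \<in> ?A" "b \<in> ?A" for a b
      using that gam_comm[OF Mc] gM by blast
    have "fin_index (generate G (S \<union> ?N)) ?N"
      by (rule fin_index_generate_torsion[OF subgroup_gam[OF M(1)] N(1) gam_Suc_subset[OF M] ab S(1,2) tors''])
    \<comment> \<open>The previous bound concerns the abstract subgroup; closedness of
      \<open>?N\<close> carries it over to the closure.\<close>
    then have "fin_index (cgen (S \<union> ?N)) ?N"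
      unfolding closed_generate_def using S gc by (intro fin_index_closure N generate_incl) blast+
    then have "fin_index ?A ?N" using S(3) fin_index_mono by blast
    with Suc have "fin_index (gam c M) ?N" using fin_index_trans gc by blast
    then show ?case by simp
  }
qed

end

section \<open>Profinite groups\<close>

context profinite_group
begin

text \<open>Compactness extracts a finite subcover from the open left cosets.\<close>

lemma fin_index_open_subgroup:
  assumes U: "subgroup U G" "openin T U"
  shows "fin_index (carrier G) U"
proof -
  interpret U: subgroup U G by fact
  define C where "C = (\<lambda>x. {z \<in> carrier G. inv x \<otimes> z \<in> U})"
  have "\<forall>V\<in>C ` carrier G. openin T V" using openin_coset[OF U(2)] by (auto simp: C_def)
  moreover have "topspace T \<subseteq> \<Union>(C ` carrier G)" by (auto simp: C_def topspace_eq_carrier)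
  ultimately obtain \<F> where "finite \<F>" "\<F> \<subseteq> C ` carrier G" "topspace T \<subseteq> \<Union>\<F>"
    using compact unfolding compact_space_alt by meson
  then obtain F where F: "finite F" "F \<subseteq> carrier G" "topspace T \<subseteq> \<Union>(C ` F)"
    by (metis finite_subset_image)
  then show ?thesis unfolding fin_index_def
    by (intro exI[of _ F]) (auto simp: C_def topspace_eq_carrier)
qed

text \<open>Residual finiteness, derived from compactness and total disconnectedness.\<close>

lemma open_normal_separation:
  assumes x: "x \<in> carrier G" "x \<noteq> \<one>"
  shows "\<exists>N. N \<lhd> G \<and> openin T N \<and> x \<notin> N"
proof -
  have "\<not> connected_component_of T \<one> x"
    using totally_disconnected x(2) unfolding connected_component_of_def by (metis singletonD subsetD)
  \<comment> \<open>In a compact Hausdorff space components and quasi-components agree, so a clopen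
    set \<open>W\<close> separates \<open>\<one>\<close> from \<open>x\<close>.\<close>
  then have "\<not> quasi_component_of T \<one> x"
    using quasi_eq_connected_component_of compact Hausdorff by metis
  then obtain W where W: "closedin T W" "openin T W" "\<one> \<in> W" "x \<notin> W"
    using x(1) unfolding quasi_component_of by (auto simp: topspace_eq_carrier)
  have Wc: "W \<subseteq> carrier G" using W openin_sub_carrier by blast
  \<comment> \<open>\<open>V\<close> is open by compactness, and \<open>V \<inter> V\<^sup>-\<^sup>1\<close> is the stabilizer of \<open>W\<close> under right translation.\<close>
  define V where "V = {g \<in> carrier G. \<forall>w\<in>W. w \<otimes> g \<in> W}"
  have "openin T V"
  proof -
    let ?P = "prod_topology T T"
    \<comment> \<open>The pairs \<open>(w, g)\<close> with \<open>w\<close> in \<open>W\<close> and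
      \<open>w \<otimes> g\<close> outside \<open>W\<close>. The projection to \<open>g\<close> is a
      closed map since the other factor is compact, and \<open>V\<close> is the complement of the
      image.\<close>
    let ?B = "{p \<in> topspace ?P. fst p \<in> W} \<inter> {p \<in> topspace ?P. fst p \<otimes> snd p \<in> carrier G - W}"
    have "closedin T (carrier G - W)" using W(2) by (metis closedin_def closedin_diff closedin_topspace topspace_eq_carrier openin_closedin_eq)
    moreover have "continuous_map ?P T (\<lambda>p. fst p \<otimes> snd p)"
      using continuous_mult by (simp add: case_prod_beta')
    ultimately have "closedin ?P ?B"
      by (intro closedin_Int closedin_continuous_map_preimage[of ?P T] W continuous_map_fst)
    then have "closedin T (snd ` ?B)"
      using closed_map_snd[OF compact] unfolding closed_map_def by blast
    from openin_diff[OF openin_topspace this] have "openin T (carrier G - snd ` ?B)"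
      by (simp only: topspace_eq_carrier)
    moreover have "V = carrier G - snd ` ?B"
      using Wc by (force simp: V_def topspace_eq_carrier)
    ultimately show ?thesis by (simp only:)
  qed
  define U where "U = V \<inter> {g \<in> carrier G. inv g \<in> V}"
  have "openin T U" unfolding U_def
    using \<open>openin T V\<close> by (intro openin_Int openin_preimage continuous_intros_group)
  have "subgroup U G"
  proof (rule subgroupI)
    show "U \<subseteq> carrier G" by (auto simp: U_def)
    have "\<one> \<in> U" using Wc by (auto simp: U_def V_def)
    then show "U \<noteq> {}" by blast
    show "inv a \<in> U" if "a \<in> U" for a using that by (auto simp: U_def)
    have V: "a \<otimes> b \<in> V" if "a \<in> V" "b \<in> V" for a b
      using that Wc by (auto simp: V_def m_assoc[symmetric] subsetD)
    show "a \<otimes> b \<in> U" if "a \<in> U" "b \<in> U" for a b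
      using that V by (auto simp: U_def inv_mult_group)
  qed
  \<comment> \<open>Right translation by \<open>x\<close> takes \<open>\<one>\<close>, a point of
    \<open>W\<close>, to \<open>x\<close>, which is outside \<open>W\<close>.\<close>
  moreover have "x \<notin> U" using W x by (auto simp: U_def V_def intro!: bexI[of _ \<one>])
  ultimately show ?thesis
    using open_normal_core[OF \<open>subgroup U G\<close> \<open>openin T U\<close> fin_index_open_subgroup] \<open>openin T U\<close> by blast
qed

section \<open>Virtual nilpotency versus finiteness of the family\<close>

lemma virtually_nilpotent_if_finite:
  assumes fin: "finite {gam c K | K. K \<lhd> G \<and> openin T K}"
  shows "virtually_nilpotent G T c"
proof -
  let ?P = "\<lambda>K. K \<lhd> G \<and> openin T K"
  have "{gam c K | K. ?P K} \<subseteq> gam c ` {K. ?P K}" by blast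
  \<comment> \<open>\<open>I\<close> consists of finitely many subgroups realising all the values,
    so that a single open normal \<open>N\<close> fits inside all of them.\<close>
  from finite_subset_image[OF fin this]
  obtain I where I: "finite I" "I \<subseteq> {K. ?P K}" "{gam c K | K. ?P K} = gam c ` I"
    by blast
  obtain N where N: "N \<lhd> G" "openin T N" "\<And>K. K \<in> I \<Longrightarrow> N \<subseteq> K"
    using open_normal_finite_inter[OF I(1)] I(2) by blast
  \<comment> \<open>For arbitrary \<open>K\<close>, some \<open>L\<close> in \<open>I\<close> has
    \<open>gam c L = gam c K\<close>; hence \<open>gam c N\<close> lies in \<open>gam c K\<close>
    and so in \<open>K\<close>.\<close>
  have sub: "gam c N \<subseteq> K" if K: "?P K" for K
  proof -
    obtain L where L: "L \<in> I" "gam c K = gam c L" using K I(3) by blast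
    have "closedin T K" using K closedin_open_subgroup normal_imp_subgroup by blast
    then have "gam c K \<subseteq> K" using gam_antimono[of K 0 c] K by simp
    moreover have "gam c N \<subseteq> gam c L" by (rule gam_mono[OF N(3)[OF L(1)]])
    ultimately show ?thesis using L by simp
  qed
  have "gam c N \<subseteq> carrier G" by (intro gam_sub_carrier normal_subset N)
  then have "gam c N \<subseteq> {\<one>}" using sub open_normal_separation by blast
  moreover have "\<one> \<in> gam c N" using subgroup.one_closed[OF subgroup_gam[OF N(1)]] .
  ultimately have "gam c N = {\<one>}" by blast
  moreover have "finite (rcosets N)"
    using fin_index_open_subgroup finite_rcosets_iff_fin_index N normal_imp_subgroup by blast
  ultimately show ?thesis unfolding virtually_nilpotent_def
    using normal_imp_subgroup[OF N(1)] by auto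
qed

lemma finite_if_virtually_nilpotent:
  assumes "virtually_nilpotent G T c" and "top_fin_gen G T"
  shows "finite {gam c K | K. K \<lhd> G \<and> openin T K}"
proof -
  obtain H0 where H0: "subgroup H0 G" "finite (rcosets H0)" "gam c H0 = {\<one>}"
    using assms(1) unfolding virtually_nilpotent_def by auto
  \<comment> \<open>Passing from \<open>H0\<close> to its closure and then into the normal core of
    the closure keeps \<open>gam c\<close> trivial and produces an open normal subgroup.\<close>
  let ?H1 = "T closure_of H0"
  have H0c: "H0 \<subseteq> carrier G" using H0(1) by (rule subgroup.subset)
  have H1: "subgroup ?H1 G" "closedin T ?H1" using subgroup_closure[OF H0(1)] by auto
  have "fin_index (carrier G) H0" using finite_rcosets_iff_fin_index H0 by blast
  then have H1_fin: "fin_index (carrier G) ?H1"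
    by (rule fin_index_mono) (use subset_closure[OF H0c] in auto)
  have "closedin T {\<one>}" using Hausdorff by (simp add: closedin_Hausdorff_sing_eq topspace_eq_carrier)
  then have "gam c ?H1 \<subseteq> {\<one>}"
    using gam_closure[OF H0c, of c] H0(3) by (simp add: closure_of_closedin)
  moreover obtain H where H: "H \<lhd> G" "openin T H" "H \<subseteq> ?H1"
    using open_normal_core[OF H1(1) openin_closed_fin_index[OF H1 H1_fin] H1_fin] by blast
  ultimately have nil: "gam c H \<subseteq> {\<one>}" using gam_mono by blast
  have Hsub: "subgroup H G" using H normal_imp_subgroup by blast
  have H_cl: "closedin T H" by (rule closedin_open_subgroup[OF Hsub H(2)])
  have H_fin: "fin_index (carrier G) H" by (rule fin_index_open_subgroup[OF Hsub H(2)])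
  obtain S where S: "finite S" "S \<subseteq> carrier G" "cgen S = carrier G"
    using assms(2) unfolding top_fin_gen_def by blast
  \<comment> \<open>Each \<open>gam c K\<close> will be caught among the finitely many subgroups
    between \<open>gam (2 * c) M\<close> and \<open>gam c M\<close>, for one of the finitely many
    normal \<open>M\<close> containing \<open>H\<close>.\<close>
  let ?\<M> = "{M. M \<lhd> G \<and> H \<subseteq> M}"
  let ?\<L> = "\<lambda>M. {L. subgroup L G \<and> gam (2 * c) M \<subseteq> L \<and> L \<subseteq> gam c M}"
  have "?\<M> \<subseteq> {M. subgroup M G \<and> H \<subseteq> M \<and> M \<subseteq> carrier G}"
    by (auto simp: normal_imp_subgroup dest: normal_subset)
  then have fin_M: "finite ?\<M>"
    by (rule finite_subset) (rule finite_intermediate_subgroups[OF H_fin subset_refl])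
  have "finite (?\<L> M)" if M: "M \<in> ?\<M>" for M
  proof -
    have MG: "M \<lhd> G" "subgroup M G" "H \<subseteq> M" using M normal_imp_subgroup by auto
    have Mo: "openin T M" by (rule openin_supergroup[OF Hsub H(2) MG(2,3)])
    have Mcl: "closedin T M" by (rule closedin_open_subgroup[OF MG(2) Mo])
    \<comment> \<open>Finite generation passes from \<open>G\<close> to the open subgroup
      \<open>M\<close>; the generators are torsion modulo \<open>H\<close> because \<open>H\<close>
      has finite index.\<close>
    obtain Y where Y: "finite Y" "Y \<subseteq> M" "cgen Y = M"
      using open_subgroup_fin_gen[OF S MG(2) Mo fin_index_open_subgroup[OF MG(2) Mo]] by blast
    have "fin_index (gam c M) (gam (c + c) M)"
      using Y normal_subset[OF MG(1)]
      by (intro fin_index_gam[OF MG(1) Mcl H(1) H_cl MG(3) Y(1,2) _ _ nil]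
          fin_index_normal_torsion[OF H(1) H_fin]) auto
    then show ?thesis
      using finite_intermediate_subgroups gam_sub_carrier[OF normal_subset[OF MG(1)]]
      by (metis mult_2)
  qed
  then have "finite (\<Union>M\<in>?\<M>. ?\<L> M)" using fin_M by blast
  moreover have "gam c K \<in> (\<Union>M\<in>?\<M>. ?\<L> M)" if K: "K \<lhd> G" "openin T K" for K
  proof -
    \<comment> \<open>The product \<open>K H\<close>, generated abstractly. It contains the open
      subgroup \<open>H\<close> and is therefore itself open.\<close>
    let ?M = "generate G (K \<union> H)"
    have KH: "K \<union> H \<subseteq> carrier G" using K H normal_subset by blast
    have K_cl: "closedin T K" using K closedin_open_subgroup normal_imp_subgroup by blast
    have M: "?M \<lhd> G"
      by (rule normal_generateI[OF KH])
        (use normal.inv_op_closed2[OF K(1)] normal.inv_op_closed2[OF H(1)] in blast)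
    have KM: "K \<subseteq> ?M" and HM: "H \<subseteq> ?M" using generate_sincl[of "K \<union> H"] by auto
    have "?M \<subseteq> cgen (K \<union> H)"
      unfolding closed_generate_def by (rule subset_closure[OF generate_incl[OF KH]])
    then have "gam (2 * c) ?M \<subseteq> gam c K"
      by (rule gam_double_subset[OF K(1) K_cl H(1) H_cl nil])
    then have "gam c K \<in> ?\<L> ?M"
      using gam_mono[OF KM] subgroup_gam[OF K(1)] by simp
    with M HM show ?thesis by (intro UN_I[of ?M]) simp_all
  qed
  then have "{gam c K | K. K \<lhd> G \<and> openin T K} \<subseteq> (\<Union>M\<in>?\<M>. ?\<L> M)" by blast
  ultimately show ?thesis by (rule finite_subset[rotated])
qed

end

theorem theorem1:
  fixes G :: "('a, 'b) monoid_scheme" and T :: "'a topology" and c :: nat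
  assumes "profinite_group G T"
    and "top_fin_gen G T"
  shows "virtually_nilpotent G T c \<longleftrightarrow>
    finite {lower_central G T (c + 1) K | K. K \<lhd> G \<and> openin T K}"
proof -
  interpret profinite_group G T by fact
  show ?thesis
    using finite_if_virtually_nilpotent[OF _ assms(2)] virtually_nilpotent_if_finite by auto
qed

end
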